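(* Let $1<p<+\infty$ and let $I:RM(p,0)\rightarrow A^p$ be the inclusion map. Then, identifying $(A^p)^{**}$ with $A^p$ (which is reflexive), $I^{**}:(RM(p,0))^{**}\rightarrow A^p$ is continuous and injective. Moreover: (1) $I^{**}((RM(p,0))^{**})=RM(p,\infty)$; (2) $I^{**}:(RM(p,0))^{**}\rightarrow RM(p,\infty)$ is an isometry, where $RM(p,\infty)$ carries the norm $\rho_{p,\infty}$. In addition, if $\{x_n\}$ is a bounded sequence in $(RM(p,0))^{**}$ that converges to $0$ in the weak-$*$ topology, then $\{I^{**}(x_n)\}$ converges to $0$ uniformly on compact subsets of the unit disc.
   Context: $\mathbb{D}$ is the open unit disc of $\mathbb{C}$ and $\mathcal{H}(\mathbb{D})$ the space of analytic functions on $\mathbb{D}$. For $1\le p<+\infty$, $RM(p,\infty)=\{f\in\mathcal{H}(\mathbb{D}):\rho_{p,\infty}(f)<+\infty\}$, a Banach space with norm $\rho_{p,\infty}(f)=\operatorname{ess\,sup}_{t\in[0,2\pi)}\big(\int_0^1|f(re^{it})|^p\,dr\big)^{1/p}$. $RM(p,0)$ is the closed subspace of $RM(p,\infty)$ (with the same norm) consisting of the $f\in\mathcal{H}(\mathbb{D})$ with $\lim_{\rho\to1}\sup_\theta\big(\int_\rho^1|f(re^{i\theta})|^p\,dr\big)^{1/p}=0$. $A^p$ is the Bergman space $RM(p,p)$, i.e. the analytic functions $f$ on $\mathbb{D}$ with $\rho_{p,p}(f)=\big(\frac{1}{2\pi}\int_0^{2\pi}\int_0^1|f(re^{it})|^p\,dr\,dt\big)^{1/p}<+\infty$,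 with norm $\rho_{p,p}$. Clearly $RM(p,0)\subset RM(p,\infty)\subset A^p$. $X^*$, $X^{**}$ denote the dual and bidual of a Banach space $X$, and $I^{**}$ the second adjoint of $I$. *)

theory Defs
  imports "HOL-Complex_Analysis.Complex_Analysis" "HOL-Probability.Essential_Supremum"
begin

text \<open>
  The exponent \<open>p\<close> is a variable, so the spaces are not types but carrier sets. A complex normed
  space is given by a set \<open>V\<close> of functions \<open>'i \<Rightarrow> complex\<close>, with pointwise operations, and a norm
  \<open>N :: ('i \<Rightarrow> complex) \<Rightarrow> real\<close> that matters on \<open>V\<close> only. A functional on \<open>V\<close> is again a
  complex-valued function (of type \<open>('i \<Rightarrow> complex) \<Rightarrow> complex\<close>), so that duals and biduals are
  spaces of the same kind. Functions are set to 0 off their domain (the disc, or the space on which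
  a functional acts), so that HOL equality is equality on that domain.
\<close>

subsection \<open>Normed spaces of functions and their duals\<close>

text \<open>The value 0 off \<open>V\<close> only serves to meet the unrestricted axioms of \<^locale>\<open>Metric_space\<close>.\<close>

definition norm_dist ::
  "('i \<Rightarrow> complex) set \<Rightarrow> (('i \<Rightarrow> complex) \<Rightarrow> real) \<Rightarrow> ('i \<Rightarrow> complex) \<Rightarrow> ('i \<Rightarrow> complex) \<Rightarrow> real"
where
  "norm_dist V N x y = (if x \<in> V \<and> y \<in> V then N (\<lambda>i. x i - y i) else 0)"

definition norm_topology ::
  "('i \<Rightarrow> complex) set \<Rightarrow> (('i \<Rightarrow> complex) \<Rightarrow> real) \<Rightarrow> ('i \<Rightarrow> complex) topology"
where
  "norm_topology V N = Metric_space.mtopology V (norm_dist V N)"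

definition dual_space ::
  "('i \<Rightarrow> complex) set \<Rightarrow> (('i \<Rightarrow> complex) \<Rightarrow> real) \<Rightarrow> (('i \<Rightarrow> complex) \<Rightarrow> complex) set"
where
  "dual_space V N = {\<phi>.
     (\<forall>x. x \<notin> V \<longrightarrow> \<phi> x = 0) \<and>
     (\<forall>x\<in>V. \<forall>y\<in>V. \<phi> (\<lambda>i. x i + y i) = \<phi> x + \<phi> y) \<and>
     (\<forall>c. \<forall>x\<in>V. \<phi> (\<lambda>i. c * x i) = c * \<phi> x) \<and>
     (\<exists>C. \<forall>x\<in>V. cmod (\<phi> x) \<le> C * N x)}"

definition dual_norm ::
  "('i \<Rightarrow> complex) set \<Rightarrow> (('i \<Rightarrow> complex) \<Rightarrow> real) \<Rightarrow> (('i \<Rightarrow> complex) \<Rightarrow> complex) \<Rightarrow> real"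
where
  "dual_norm V N \<phi> = (SUP x\<in>{x \<in> V. N x \<le> 1}. cmod (\<phi> x))"

abbreviation bidual_space ::
  "('i \<Rightarrow> complex) set \<Rightarrow> (('i \<Rightarrow> complex) \<Rightarrow> real) \<Rightarrow> ((('i \<Rightarrow> complex) \<Rightarrow> complex) \<Rightarrow> complex) set"
where
  "bidual_space V N \<equiv> dual_space (dual_space V N) (dual_norm V N)"

abbreviation bidual_norm ::
  "('i \<Rightarrow> complex) set \<Rightarrow> (('i \<Rightarrow> complex) \<Rightarrow> real) \<Rightarrow> ((('i \<Rightarrow> complex) \<Rightarrow> complex) \<Rightarrow> complex) \<Rightarrow> real"
where
  "bidual_norm V N \<equiv> dual_norm (dual_space V N) (dual_norm V N)"

text \<open>The weak-* topology of the dual of \<open>(V, N)\<close>.\<close>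

definition weak_star_topology ::
  "('i \<Rightarrow> complex) set \<Rightarrow> (('i \<Rightarrow> complex) \<Rightarrow> real) \<Rightarrow> (('i \<Rightarrow> complex) \<Rightarrow> complex) topology"
where
  "weak_star_topology V N =
     topology_generated_by {{\<phi> \<in> dual_space V N. \<phi> x \<in> U} | x U. x \<in> V \<and> open U}"

definition canonical_embedding ::
  "('i \<Rightarrow> complex) set \<Rightarrow> (('i \<Rightarrow> complex) \<Rightarrow> real) \<Rightarrow> ('i \<Rightarrow> complex) \<Rightarrow> (('i \<Rightarrow> complex) \<Rightarrow> complex) \<Rightarrow> complex"
where
  "canonical_embedding V N x = (\<lambda>\<phi>. if \<phi> \<in> dual_space V N then \<phi> x else 0)"

text \<open>
  The Banach space adjoint of a bounded linear operator \<open>T\<close> with domain \<open>V\<close>; the constant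
  \<open>adjoint\<close> of HOL-Analysis is the one for real inner product spaces.
\<close>

definition banach_adjoint ::
  "('i \<Rightarrow> complex) set \<Rightarrow> (('i \<Rightarrow> complex) \<Rightarrow> ('j \<Rightarrow> complex)) \<Rightarrow>
   (('j \<Rightarrow> complex) \<Rightarrow> complex) \<Rightarrow> ('i \<Rightarrow> complex) \<Rightarrow> complex"
where
  "banach_adjoint V T \<phi> = (\<lambda>x. if x \<in> V then \<phi> (T x) else 0)"

subsection \<open>The spaces of average radial integrability\<close>

definition disc :: "complex set" where
  "disc = ball 0 1"

definition hol_disc :: "(complex \<Rightarrow> complex) set" where
  "hol_disc = {f. f holomorphic_on disc \<and> (\<forall>z. z \<notin> disc \<longrightarrow> f z = 0)}"

text \<open>Real powers on \<open>[0, \<infinity>]\<close>, used for positive exponents only.\<close>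

definition ennreal_powr :: "ennreal \<Rightarrow> real \<Rightarrow> ennreal" where
  "ennreal_powr x a = (if x = \<infinity> then \<infinity> else ennreal (enn2real x powr a))"

definition radial_integral :: "real \<Rightarrow> real \<Rightarrow> (complex \<Rightarrow> complex) \<Rightarrow> real \<Rightarrow> ennreal" where
  "radial_integral p s f t =
     (\<integral>\<^sup>+r\<in>{s<..<1}. ennreal (cmod (f (complex_of_real r * cis t)) powr p) \<partial>lborel)"

definition rho_infty :: "real \<Rightarrow> (complex \<Rightarrow> complex) \<Rightarrow> ennreal" where
  "rho_infty p f =
     esssup (restrict_space lborel {0..<2 * pi}) (\<lambda>t. ennreal_powr (radial_integral p 0 f t) (1 / p))"

definition RM_infty :: "real \<Rightarrow> (complex \<Rightarrow> complex) set" where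
  "RM_infty p = {f \<in> hol_disc. rho_infty p f < \<infinity>}"

definition RM_infty_norm :: "real \<Rightarrow> (complex \<Rightarrow> complex) \<Rightarrow> real" where
  "RM_infty_norm p f = enn2real (rho_infty p f)"

definition RM_zero :: "real \<Rightarrow> (complex \<Rightarrow> complex) set" where
  "RM_zero p = {f \<in> hol_disc.
     ((\<lambda>s. SUP t. ennreal_powr (radial_integral p s f t) (1 / p)) \<longlongrightarrow> 0) (at_left 1)}"

definition rho_bergman :: "real \<Rightarrow> (complex \<Rightarrow> complex) \<Rightarrow> ennreal" where
  "rho_bergman p f =
     ennreal_powr (ennreal (1 / (2 * pi)) * (\<integral>\<^sup>+t\<in>{0..2 * pi}. radial_integral p 0 f t \<partial>lborel)) (1 / p)"

definition bergman :: "real \<Rightarrow> (complex \<Rightarrow> complex) set" where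
  "bergman p = {f \<in> hol_disc. rho_bergman p f < \<infinity>}"

definition bergman_norm :: "real \<Rightarrow> (complex \<Rightarrow> complex) \<Rightarrow> real" where
  "bergman_norm p f = enn2real (rho_bergman p f)"

subsection \<open>The second adjoint of the inclusion\<close>

definition inclusion_adjoint2 ::
  "real \<Rightarrow> (((complex \<Rightarrow> complex) \<Rightarrow> complex) \<Rightarrow> complex) \<Rightarrow> ((complex \<Rightarrow> complex) \<Rightarrow> complex) \<Rightarrow> complex"
where
  "inclusion_adjoint2 p =
     banach_adjoint (dual_space (bergman p) (bergman_norm p)) (banach_adjoint (RM_zero p) (\<lambda>f. f))"

text \<open>
  The second adjoint with its values in the bidual of the Bergman space identified with elements of
  the Bergman space; this is meaningful because the canonical embedding of the latter is bijective.
\<close>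

definition I_bidual ::
  "real \<Rightarrow> (((complex \<Rightarrow> complex) \<Rightarrow> complex) \<Rightarrow> complex) \<Rightarrow> complex \<Rightarrow> complex"
where
  "I_bidual p \<Phi> =
     inv_into (bergman p) (canonical_embedding (bergman p) (bergman_norm p)) (inclusion_adjoint2 p \<Phi>)"

end

theory Submission
  imports Defs "HOL-Probability.Probability_Measure"
begin

text \<open>
  Both \<open>A\<^sup>p\<close> and \<open>RM(p,0)\<close> have norms of the form \<open>sup (\<integral>|f|\<^sup>p d\<mu>)\<close>, to the power \<open>1/p\<close>, over a family of
  measures \<open>\<mu>\<close> on the disc. If \<open>f\<^sub>n\<close> is bounded and tends to 0 locally uniformly, a gliding hump turns
  it into almost disjointly supported functions, whose sums of length \<open>k\<close> have norm \<open>O(k powr (1/p))\<close>;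
  since \<open>p > 1\<close>, every bounded functional \<open>\<phi>\<close> satisfies \<open>\<phi> f\<^sub>n \<rightarrow> 0\<close>.

  Goldstine's theorem and Montel's theorem then give, for \<open>\<Phi>\<close> in the bidual, a bounded sequence
  \<open>f\<^sub>n\<close> converging locally uniformly to \<open>g(z) = \<Phi>(evaluation at z)\<close> with \<open>\<phi> f\<^sub>n \<rightarrow> \<Phi> \<phi>\<close>. By the first
  step \<open>\<Phi>\<close> is determined by \<open>g\<close>, and Fatou's lemma gives \<open>\<rho>(g) \<le> \<parallel>\<Phi>\<parallel>\<close>. Conversely, every \<open>g\<close> of finite norm
  arises, with \<open>\<parallel>\<Phi>\<parallel> \<le> \<rho>(g)\<close>, as the limit along its dilations \<open>g(rz)\<close>, \<open>r \<rightarrow> 1\<close>, which lie in \<open>RM(p,0)\<close>.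
  For \<open>A\<^sup>p\<close> this is reflexivity, for \<open>RM(p,0)\<close> it identifies the bidual with \<open>RM(p,\<infinity>)\<close>, and
  \<open>I\<^sup>*\<^sup>*\<close> is the map \<open>\<Phi> \<mapsto> g\<close>.
\<close>

subsection \<open>Normed spaces of functions\<close>

text \<open>A bidual element is approximated by a sequence on countably many functionals only. So
  each \<phi> gets its own sequence, and evaluations at a countable set with a limit point tie its
  limit to \<open>g\<close>. That the choice of sequence does not matter is the gain from the
  gliding hump: two bounded sequences with the same locally uniform limit differ by one that every
  \<phi> sends to 0. The same fact replaces weak-* compactness in the converse direction, where the
  values of \<phi> along the dilations are shown to be Cauchy. The humps must be almost disjoint for
  all measures at once; the uniformly small tails that define \<open>RM(p,0)\<close> provide this.
  For a single measure small tails are automatic, which is why the argument returns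
  \<open>A^p\<close> itself. The second adjoint acts by restricting functionals, and an evaluation
  restricts to an evaluation, so both biduals yield the same function \<open>g\<close>.\<close>

locale normed_functions =
  fixes V :: "('i \<Rightarrow> complex) set" and N :: "('i \<Rightarrow> complex) \<Rightarrow> real"
  assumes zero: "(\<lambda>_. 0) \<in> V"
    and add: "x \<in> V \<Longrightarrow> y \<in> V \<Longrightarrow> (\<lambda>i. x i + y i) \<in> V"
    and scale: "x \<in> V \<Longrightarrow> (\<lambda>i. c * x i) \<in> V"
    and norm_nonneg: "x \<in> V \<Longrightarrow> 0 \<le> N x"
    and norm_scale: "x \<in> V \<Longrightarrow> N (\<lambda>i. c * x i) = cmod c * N x"
    and norm_triangle: "x \<in> V \<Longrightarrow> y \<in> V \<Longrightarrow> N (\<lambda>i. x i + y i) \<le> N x + N y"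
    and norm_definite: "x \<in> V \<Longrightarrow> N x = 0 \<Longrightarrow> x i = 0"
begin

lemma diff: "x \<in> V \<Longrightarrow> y \<in> V \<Longrightarrow> (\<lambda>i. x i - y i) \<in> V"
  using add[OF _ scale[of y "-1"], of x] by simp

lemma norm_zero: "N (\<lambda>_. 0) = 0"
  using norm_scale[OF zero, of 0] by simp

lemma norm_diff_le: "x \<in> V \<Longrightarrow> y \<in> V \<Longrightarrow> N (\<lambda>i. x i - y i) \<le> N x + N y"
  using norm_triangle[OF _ scale[of y "-1"], of x] norm_scale[of y "-1"] by simp

lemma norm_diff_commute:
  assumes "x \<in> V" "y \<in> V"
  shows "N (\<lambda>i. x i - y i) = N (\<lambda>i. y i - x i)"
  using norm_scale[OF diff[OF assms], of "-1"] by simp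

lemma Metric_space_norm_dist: "Metric_space V (norm_dist V N)"
proof
  show "0 \<le> norm_dist V N x y" for x y
    by (simp add: norm_dist_def norm_nonneg diff)
  show "norm_dist V N x y = norm_dist V N y x" for x y
    using norm_diff_commute[of x y] by (auto simp: norm_dist_def)
  show "norm_dist V N x y = 0 \<longleftrightarrow> x = y" if "x \<in> V" "y \<in> V" for x y
    using that norm_definite[OF diff[OF that]] norm_zero by (auto simp: norm_dist_def)
  show "norm_dist V N x z \<le> norm_dist V N x y + norm_dist V N y z"
    if "x \<in> V" "y \<in> V" "z \<in> V" for x y z
    using norm_triangle[OF diff diff, of x y y z] that by (simp add: norm_dist_def)
qed

lemma dualI:
  assumes "\<And>x. x \<notin> V \<Longrightarrow> \<phi> x = 0"
    and "\<And>x y. x \<in> V \<Longrightarrow> y \<in> V \<Longrightarrow> \<phi> (\<lambda>i. x i + y i) = \<phi> x + \<phi> y"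
    and "\<And>c x. x \<in> V \<Longrightarrow> \<phi> (\<lambda>i. c * x i) = c * \<phi> x"
    and "\<And>x. x \<in> V \<Longrightarrow> cmod (\<phi> x) \<le> C * N x"
  shows "\<phi> \<in> dual_space V N"
  unfolding dual_space_def using assms by blast

lemma dual_outside: "\<phi> \<in> dual_space V N \<Longrightarrow> x \<notin> V \<Longrightarrow> \<phi> x = 0"
  and dual_add: "\<phi> \<in> dual_space V N \<Longrightarrow> x \<in> V \<Longrightarrow> y \<in> V \<Longrightarrow> \<phi> (\<lambda>i. x i + y i) = \<phi> x + \<phi> y"
  and dual_scale: "\<phi> \<in> dual_space V N \<Longrightarrow> x \<in> V \<Longrightarrow> \<phi> (\<lambda>i. c * x i) = c * \<phi> x"
  by (auto simp: dual_space_def)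

lemma dual_zero: "\<phi> \<in> dual_space V N \<Longrightarrow> \<phi> (\<lambda>_. 0) = 0"
  using dual_scale[OF _ zero, of \<phi> 0] by simp

lemma dual_diff:
  "\<phi> \<in> dual_space V N \<Longrightarrow> x \<in> V \<Longrightarrow> y \<in> V \<Longrightarrow> \<phi> (\<lambda>i. x i - y i) = \<phi> x - \<phi> y"
  using dual_add[OF _ _ scale[of y "-1"], of \<phi> x] dual_scale[of \<phi> y "-1"] by simp

lemma dual_norm_bdd_above:
  assumes "\<phi> \<in> dual_space V N"
  shows "bdd_above ((\<lambda>x. cmod (\<phi> x)) ` {x \<in> V. N x \<le> 1})"
proof -
  obtain C where C: "\<And>x. x \<in> V \<Longrightarrow> cmod (\<phi> x) \<le> C * N x"
    using assms unfolding dual_space_def by blast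
  \<comment> \<open>The constant in \<open>dual_space\<close> carries no sign: if \<open>N\<close>
    vanishes on \<open>V\<close>, it may be negative.\<close>
  have "cmod (\<phi> x) \<le> \<bar>C\<bar>" if "x \<in> V" "N x \<le> 1" for x
  proof -
    have "C * N x \<le> \<bar>C\<bar> * 1"
      using that norm_nonneg by (intro mult_mono) auto
    then show ?thesis using C[OF that(1)] by simp
  qed
  then show ?thesis by (auto intro!: bdd_aboveI2)
qed

lemma dual_norm_nonneg: "\<phi> \<in> dual_space V N \<Longrightarrow> 0 \<le> dual_norm V N \<phi>"
  unfolding dual_norm_def
  using zero norm_zero dual_zero by (intro cSUP_upper2[OF dual_norm_bdd_above, of _ "\<lambda>_. 0"]) auto

lemma dual_bound:
  assumes "\<phi> \<in> dual_space V N" "x \<in> V"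
  shows "cmod (\<phi> x) \<le> dual_norm V N \<phi> * N x"
proof (cases "N x = 0")
  case True
  then have "x = (\<lambda>_. 0)" using norm_definite[OF assms(2)] by auto
  with dual_zero[OF assms(1)] True show ?thesis by simp
next
  case False
  with norm_nonneg[OF assms(2)] have pos: "N x > 0" by simp
  have "cmod (\<phi> (\<lambda>i. of_real (1 / N x) * x i)) \<le> dual_norm V N \<phi>"
    unfolding dual_norm_def using pos
    by (intro cSUP_upper dual_norm_bdd_above assms)
       (simp add: scale assms norm_scale norm_divide del: of_real_divide)
  then show ?thesis
    using pos assms by (simp only: dual_scale norm_mult) (simp add: field_simps norm_divide)
qed

lemma dual_norm_le:
  assumes "0 \<le> C" "\<And>x. x \<in> V \<Longrightarrow> N x \<le> 1 \<Longrightarrow> cmod (\<phi> x) \<le> C"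
  shows "dual_norm V N \<phi> \<le> C"
  unfolding dual_norm_def
proof (rule cSUP_least)
  show "{x \<in> V. N x \<le> 1} \<noteq> {}" using zero norm_zero by auto
qed (use assms in auto)

lemma dual_norm_le_bound:
  assumes "0 \<le> C" "\<And>x. x \<in> V \<Longrightarrow> cmod (\<phi> x) \<le> C * N x"
  shows "dual_norm V N \<phi> \<le> C"
proof (rule dual_norm_le)
  fix x assume "x \<in> V" "N x \<le> 1"
  then show "cmod (\<phi> x) \<le> C"
    using assms(2)[of x] mult_left_mono[of "N x" 1 C] assms(1) by simp
qed (fact assms)

lemma normed_functions_dual: "normed_functions (dual_space V N) (dual_norm V N)"
proof
  show dzero: "(\<lambda>_. 0) \<in> dual_space V N"
    by (rule dualI[where C = 0]) auto
  show dadd: "(\<lambda>x. \<phi> x + \<psi> x) \<in> dual_space V N"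
    if "\<phi> \<in> dual_space V N" "\<psi> \<in> dual_space V N" for \<phi> \<psi>
  proof (rule dualI[where C = "dual_norm V N \<phi> + dual_norm V N \<psi>"])
    fix x assume "x \<in> V"
    then show "cmod (\<phi> x + \<psi> x) \<le> (dual_norm V N \<phi> + dual_norm V N \<psi>) * N x"
      using norm_triangle_ineq[of "\<phi> x" "\<psi> x"] dual_bound[OF that(1), of x] dual_bound[OF that(2), of x]
      by (simp add: distrib_right)
  qed (use that in \<open>simp_all add: dual_outside dual_add dual_scale distrib_left\<close>)
  show dscale: "(\<lambda>x. c * \<phi> x) \<in> dual_space V N" if "\<phi> \<in> dual_space V N" for c \<phi>
  proof (rule dualI[where C = "cmod c * dual_norm V N \<phi>"])
    fix x assume "x \<in> V"
    then show "cmod (c * \<phi> x) \<le> cmod c * dual_norm V N \<phi> * N x"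
      using mult_left_mono[OF dual_bound[OF that, of x], of "cmod c"] by (simp add: norm_mult mult.assoc)
  qed (use that in \<open>simp_all add: dual_outside dual_add dual_scale distrib_left\<close>)
  show "0 \<le> dual_norm V N \<phi>" if "\<phi> \<in> dual_space V N" for \<phi>
    by (rule dual_norm_nonneg[OF that])
  have le: "dual_norm V N (\<lambda>x. c * \<phi> x) \<le> cmod c * dual_norm V N \<phi>" if "\<phi> \<in> dual_space V N" for c \<phi>
  proof (rule dual_norm_le_bound)
    fix x assume "x \<in> V"
    then show "cmod (c * \<phi> x) \<le> cmod c * dual_norm V N \<phi> * N x"
      using mult_left_mono[OF dual_bound[OF that, of x], of "cmod c"] by (simp add: norm_mult mult.assoc)
  qed (simp add: dual_norm_nonneg that)
  show "dual_norm V N (\<lambda>x. c * \<phi> x) = cmod c * dual_norm V N \<phi>" if \<phi>: "\<phi> \<in> dual_space V N" for c \<phi>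
  proof (cases "c = 0")
    case True
    then show ?thesis using dual_norm_nonneg[OF dzero] dual_norm_le_bound[of 0 "\<lambda>_. 0"] by auto
  next
    case False
    have "dual_norm V N \<phi> \<le> cmod (1 / c) * dual_norm V N (\<lambda>x. c * \<phi> x)"
      using le[OF dscale[OF \<phi>, of c], of "1 / c"] False by simp
    then have "cmod c * dual_norm V N \<phi> \<le> dual_norm V N (\<lambda>x. c * \<phi> x)"
      using False by (simp add: field_simps norm_divide)
    with le[OF \<phi>, of c] show ?thesis by simp
  qed
  show "dual_norm V N (\<lambda>x. \<phi> x + \<psi> x) \<le> dual_norm V N \<phi> + dual_norm V N \<psi>"
    if "\<phi> \<in> dual_space V N" "\<psi> \<in> dual_space V N" for \<phi> \<psi>
  proof (rule dual_norm_le_bound)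
    fix x assume "x \<in> V"
    then show "cmod (\<phi> x + \<psi> x) \<le> (dual_norm V N \<phi> + dual_norm V N \<psi>) * N x"
      using norm_triangle_ineq[of "\<phi> x" "\<psi> x"] dual_bound[OF that(1), of x] dual_bound[OF that(2), of x]
      by (simp add: distrib_right)
  qed (simp add: dual_norm_nonneg that)
  show "\<phi> x = 0" if "\<phi> \<in> dual_space V N" "dual_norm V N \<phi> = 0" for \<phi> x
    using dual_bound[OF that(1), of x] dual_outside[OF that(1), of x] that(2) by (cases "x \<in> V") auto
qed

section \<open>Goldstine's theorem for countably many functionals\<close>

lemma sum_mem:
  fixes n :: nat
  shows "(\<And>k. k < n \<Longrightarrow> x k \<in> V) \<Longrightarrow> (\<lambda>i. \<Sum>k<n. c k * x k i) \<in> V"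
  by (induction n) (simp_all add: zero add scale)

lemma dual_sum:
  fixes n :: nat
  assumes "\<phi> \<in> dual_space V N" "\<And>k. k < n \<Longrightarrow> x k \<in> V"
  shows "\<phi> (\<lambda>i. \<Sum>k<n. c k * x k i) = (\<Sum>k<n. c k * \<phi> (x k))"
  using assms(2)
proof (induction n)
  case 0
  then show ?case using dual_zero[OF assms(1)] by simp
next
  case (Suc n)
  then show ?case
    using dual_add[OF assms(1) sum_mem scale[of "x n" "c n"], of n x c] dual_scale[OF assms(1), of "x n"]
    by simp
qed

text \<open>The ball is invariant under unimodular scalars, so a bound on real parts is a bound on
  moduli. Multiplying by \<open>a\<close> instead of dividing admits radius 0, which occurs in
  \<open>goldstine\<close> when the bidual norm of \<Phi> is 0.\<close>

lemma dual_norm_le_Re: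
  assumes "\<psi> \<in> dual_space V N" "0 \<le> a" "\<And>y. y \<in> V \<Longrightarrow> N y \<le> a \<Longrightarrow> Re (\<psi> y) \<le> b"
  shows "a * dual_norm V N \<psi> \<le> b"
proof (cases "a = 0")
  case True
  then show ?thesis using assms(3)[OF zero] dual_zero[OF assms(1)] norm_zero by simp
next
  case False
  with assms(2) have a: "a > 0" by simp
  have *: "a * cmod (\<psi> x) \<le> b" if x: "x \<in> V" "N x \<le> 1" for x
  proof -
    \<comment> \<open>\<open>u\<close> rotates \<open>\<psi> x\<close> onto the nonnegative real
      axis; 1 is a placeholder when \<open>\<psi> x = 0\<close>.\<close>
    define u where "u = (if \<psi> x = 0 then 1 else cnj (\<psi> x) / cmod (\<psi> x))"
    have u: "cmod u = 1" "u * \<psi> x = cmod (\<psi> x)"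
      by (auto simp: u_def norm_divide complex_norm_square[symmetric] power2_eq_square mult.commute field_simps)
    have "Re (\<psi> (\<lambda>i. (of_real a * u) * x i)) \<le> b"
      using a x u by (intro assms(3) scale) (auto simp: norm_scale norm_mult intro: mult_left_le)
    also have "\<psi> (\<lambda>i. (of_real a * u) * x i) = of_real (a * cmod (\<psi> x))"
      using dual_scale[OF assms(1) x(1), of "of_real a * u"] u(2) by (simp only: mult.assoc of_real_mult)
    finally show ?thesis by simp
  qed
  have "0 \<le> b" using *[OF zero] dual_zero[OF assms(1)] norm_zero by simp
  then have "dual_norm V N \<psi> \<le> b / a"
    using * a by (intro dual_norm_le) (auto simp: field_simps)
  then show ?thesis using a by (simp add: field_simps)
qed

text \<open>
  Goldstine's theorem for finitely many functionals, without Hahn-Banach: at a near-minimiser \<open>x\<close>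
  of the squared distance, the first variation bounds the functional \<open>\<psi> = \<Sum>k. cnj (v k) \<phi> k\<close> on the
  ball by about \<open>Re (\<psi> x)\<close>, whereas \<open>\<Phi> \<psi> - \<psi> x\<close> is the squared distance itself.
\<close>
lemma goldstine:
  assumes \<Phi>: "\<Phi> \<in> bidual_space V N" and \<phi>: "\<And>k. k < (n::nat) \<Longrightarrow> \<phi> k \<in> dual_space V N" and "0 < \<epsilon>"
  shows "\<exists>x\<in>V. N x \<le> bidual_norm V N \<Phi> \<and> (\<Sum>k<n. (cmod (\<Phi> (\<phi> k) - \<phi> k x))\<^sup>2) < \<epsilon>"
proof -
  interpret D: normed_functions "dual_space V N" "dual_norm V N"
    by (rule normed_functions_dual)
  define a where "a = bidual_norm V N \<Phi>"
  have a: "0 \<le> a" unfolding a_def by (rule D.dual_norm_nonneg[OF \<Phi>])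
  define S where "S = {x \<in> V. N x \<le> a}"
  define F where "F x = (\<Sum>k<n. (cmod (\<Phi> (\<phi> k) - \<phi> k x))\<^sup>2)" for x
  have S0: "(\<lambda>_. 0) \<in> S" using zero norm_zero a by (simp add: S_def)
  have bdd: "bdd_below (F ` S)"
    by (rule bdd_belowI2[of _ 0]) (simp add: F_def sum_nonneg)
  define d where "d = (INF x\<in>S. F x)"
  have d_le: "d \<le> F x" if "x \<in> S" for x
    unfolding d_def by (rule cINF_lower[OF bdd that])
  \<comment> \<open>\<open>B\<close> dominates the quadratic term of the variation, as two points of
    the ball of radius \<open>a\<close> are at distance at most \<open>2 * a\<close>.\<close>
  define B where "B = (\<Sum>k<n. (dual_norm V N (\<phi> k) * (2 * a))\<^sup>2)"
  have B: "0 \<le> B" by (simp add: B_def sum_nonneg)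
  \<comment> \<open>\<open>t\<close> is the fraction of the way taken from \<open>x\<close> towards
    \<open>y\<close>: at most 1 to stay on the segment, and so small that the final error
    \<open>t * (1 + B) / 2\<close> is at most half of \<epsilon>.\<close>
  define t where "t = min 1 (\<epsilon> / (1 + B))"
  have t: "0 < t" "t \<le> 1" using \<open>0 < \<epsilon>\<close> B by (auto simp: t_def)
  have t\<epsilon>: "t * (1 + B) \<le> \<epsilon>"
  proof -
    have "t * (1 + B) \<le> \<epsilon> / (1 + B) * (1 + B)"
      using B by (intro mult_right_mono) (auto simp: t_def)
    then show ?thesis using B by simp
  qed
  \<comment> \<open>The infimum need not be attained. A defect below \<open>t\<^sup>2\<close>
    suffices: the first variation is divided by \<open>t\<close> later, which leaves a defect of
    order \<open>t\<close>.\<close>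
  obtain x where x: "x \<in> S" "F x < d + t\<^sup>2"
    using cINF_less_iff[OF _ bdd, of "d + t\<^sup>2"] S0 t unfolding d_def by auto
  have xV: "x \<in> V" using x by (simp add: S_def)
  define v where "v k = \<Phi> (\<phi> k) - \<phi> k x" for k
  define \<psi> where "\<psi> = (\<lambda>y. \<Sum>k<n. cnj (v k) * \<phi> k y)"
  have \<psi>: "\<psi> \<in> dual_space V N"
    unfolding \<psi>_def using D.sum_mem[of n \<phi> "\<lambda>k. cnj (v k)"] \<phi> by simp
  have \<Phi>\<psi>: "\<Phi> \<psi> = (\<Sum>k<n. cnj (v k) * \<Phi> (\<phi> k))"
    unfolding \<psi>_def by (rule D.dual_sum[OF \<Phi> \<phi>])
  have var: "Re (\<psi> y) \<le> Re (\<psi> x) + t * (1 + B) / 2" if y: "y \<in> V" "N y \<le> a" for y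
  proof -
    define u where "u k = \<phi> k y - \<phi> k x" for k
    define z where "z = (\<lambda>i. of_real (1 - t) * x i + of_real t * y i)"
    have zV: "z \<in> V" unfolding z_def by (intro add scale xV y)
    have "N z \<le> (1 - t) * N x + t * N y"
      unfolding z_def using t norm_triangle[OF scale[OF xV, of "of_real (1 - t)"] scale[OF y(1), of "of_real t"]]
      by (simp only: norm_scale xV y norm_of_real)
    also have "\<dots> \<le> (1 - t) * a + t * a"
      using t x y by (intro add_mono mult_left_mono) (auto simp: S_def)
    finally have zS: "z \<in> S" using zV by (simp add: S_def algebra_simps)
    have "\<phi> k z = \<phi> k x + of_real t * u k" if "k < n" for k
      unfolding z_def u_def
      by (simp only: dual_add[OF \<phi>[OF that] scale[OF xV] scale[OF y(1)]]
            dual_scale[OF \<phi>[OF that] xV] dual_scale[OF \<phi>[OF that] y(1)])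
         (simp add: algebra_simps)
    then have "F z = (\<Sum>k<n. (cmod (v k - of_real t * u k))\<^sup>2)"
      by (simp add: F_def v_def algebra_simps)
    also have "\<dots> = (\<Sum>k<n. (cmod (v k))\<^sup>2 - 2 * t * Re (cnj (v k) * u k) + t\<^sup>2 * (cmod (u k))\<^sup>2)"
      unfolding cmod_power2 by (intro sum.cong refl) (simp add: power2_eq_square algebra_simps)
    also have "\<dots> = F x - 2 * t * (\<Sum>k<n. Re (cnj (v k) * u k)) + t\<^sup>2 * (\<Sum>k<n. (cmod (u k))\<^sup>2)"
      by (simp only: F_def v_def[symmetric] sum.distrib sum_subtractf sum_distrib_left)
    also have "(\<Sum>k<n. Re (cnj (v k) * u k)) = Re (\<psi> y) - Re (\<psi> x)"
      by (simp add: \<psi>_def u_def sum_subtractf right_diff_distrib del: mult_minus_left mult_minus_right)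
    also have "(\<Sum>k<n. (cmod (u k))\<^sup>2) \<le> B"
      unfolding B_def
    proof (intro sum_mono power_mono)
      fix k assume "k \<in> {..<n}"
      then have k: "\<phi> k \<in> dual_space V N" using \<phi> by simp
      have "cmod (u k) \<le> dual_norm V N (\<phi> k) * N (\<lambda>i. y i - x i)"
        unfolding u_def using dual_bound[OF k diff[OF y(1) xV]] dual_diff[OF k y(1) xV] by simp
      also have "\<dots> \<le> dual_norm V N (\<phi> k) * (2 * a)"
        using norm_diff_le[OF y(1) xV] x y
        by (intro mult_left_mono dual_norm_nonneg k) (auto simp: S_def)
      finally show "cmod (u k) \<le> dual_norm V N (\<phi> k) * (2 * a)" .
    qed simp
    finally have "F z \<le> F x - 2 * t * (Re (\<psi> y) - Re (\<psi> x)) + t\<^sup>2 * B"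
      using t by (simp add: mult_left_mono)
    with d_le[OF zS] x(2) have "2 * t * (Re (\<psi> y) - Re (\<psi> x)) \<le> t * (t * (1 + B))"
      by (simp add: algebra_simps power2_eq_square)
    then have "2 * (Re (\<psi> y) - Re (\<psi> x)) \<le> t * (1 + B)"
      using t by (simp add: mult.assoc mult.left_commute[of 2])
    then show ?thesis by simp
  qed
  have "F x = Re (\<Phi> \<psi>) - Re (\<psi> x)"
  proof -
    have "of_real (F x) = (\<Sum>k<n. cnj (v k) * v k)"
      by (simp only: F_def v_def[symmetric] of_real_sum complex_norm_square mult.commute)
    also have "\<dots> = \<Phi> \<psi> - \<psi> x"
      unfolding \<Phi>\<psi> by (simp add: \<psi>_def sum_subtractf[symmetric] right_diff_distrib[symmetric] v_def)
    finally show ?thesis by (metis Re_complex_of_real minus_complex.simps(1))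
  qed
  also have "Re (\<Phi> \<psi>) \<le> a * dual_norm V N \<psi>"
    using D.dual_bound[OF \<Phi> \<psi>] complex_Re_le_cmod[of "\<Phi> \<psi>"] by (simp add: a_def)
  also have "\<dots> \<le> Re (\<psi> x) + t * (1 + B) / 2"
    by (rule dual_norm_le_Re[OF \<psi> a var])
  finally have "F x < \<epsilon>" using t\<epsilon> \<open>0 < \<epsilon>\<close> by simp
  then show ?thesis using x by (auto simp: S_def F_def a_def)
qed

text \<open>A diagonal choice: \<open>x n\<close> serves the first \<open>n\<close> functionals up
  to the squared error \<open>1 / (n + 1)\<close>.\<close>

lemma goldstine_sequence:
  assumes \<Phi>: "\<Phi> \<in> bidual_space V N" and \<phi>: "\<And>k::nat. \<phi> k \<in> dual_space V N"
  obtains x where "\<And>n::nat. x n \<in> V" "\<And>n. N (x n) \<le> bidual_norm V N \<Phi>"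
    "\<And>k. (\<lambda>n. \<phi> k (x n)) \<longlonglongrightarrow> \<Phi> (\<phi> k)"
proof -
  have "\<forall>n. \<exists>x. x \<in> V \<and> N x \<le> bidual_norm V N \<Phi> \<and>
      (\<Sum>k<n. (cmod (\<Phi> (\<phi> k) - \<phi> k x))\<^sup>2) < inverse (real (Suc n))"
    using goldstine[OF \<Phi> \<phi>] by (simp add: Bex_def)
  from choice[OF this] obtain x where x: "\<And>n. x n \<in> V" "\<And>n. N (x n) \<le> bidual_norm V N \<Phi>"
    "\<And>n. (\<Sum>k<n. (cmod (\<Phi> (\<phi> k) - \<phi> k (x n)))\<^sup>2) < inverse (real (Suc n))"
    by blast
  have "(\<lambda>n. \<phi> k (x n)) \<longlonglongrightarrow> \<Phi> (\<phi> k)" for k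
  proof -
    have "(\<lambda>n. (cmod (\<Phi> (\<phi> k) - \<phi> k (x n)))\<^sup>2) \<longlonglongrightarrow> 0"
    proof (rule tendsto_sandwich[OF _ _ tendsto_const LIMSEQ_inverse_real_of_nat])
      show "\<forall>\<^sub>F n in sequentially. (cmod (\<Phi> (\<phi> k) - \<phi> k (x n)))\<^sup>2 \<le> inverse (real (Suc n))"
        using eventually_gt_at_top[of k]
      proof eventually_elim
        case (elim n)
        then show ?case
          using member_le_sum[of k "{..<n}" "\<lambda>k. (cmod (\<Phi> (\<phi> k) - \<phi> k (x n)))\<^sup>2"] x(3)[of n] by simp
      qed
    qed simp
    then have "(\<lambda>n. sqrt ((cmod (\<Phi> (\<phi> k) - \<phi> k (x n)))\<^sup>2)) \<longlonglongrightarrow> sqrt 0"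
      by (rule tendsto_real_sqrt)
    then have "(\<lambda>n. \<Phi> (\<phi> k) - \<phi> k (x n)) \<longlonglongrightarrow> 0"
      by (simp add: tendsto_norm_zero_iff)
    from tendsto_diff[OF tendsto_const this, of "\<Phi> (\<phi> k)"] show ?thesis by simp
  qed
  with x that show thesis by blast
qed

end

subsection \<open>Minkowski inequality\<close>

text \<open>Convexity of the power at \<open>(x + y) / (a + b)\<close>, the mean of
  \<open>x / a\<close> and \<open>y / b\<close> with weights \<open>a / (a + b)\<close> and
  \<open>b / (a + b)\<close>. Integrated, with \<open>a\<close> and \<open>b\<close> the norms of
  two functions, it gives Minkowski's inequality.\<close>

lemma powr_add_le_convex:
  fixes x y a b p :: real
  assumes "1 \<le> p" "0 < a" "0 < b" "0 \<le> x" "0 \<le> y"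
  shows "(x + y) powr p \<le> (a + b) powr p * (a / (a + b) * (x / a) powr p + b / (a + b) * (y / b) powr p)"
proof -
  have one: "z powr p \<le> z" if "0 \<le> z" "z \<le> 1" for z :: real
    using that powr_mono'[of 1 p z] \<open>1 \<le> p\<close> by simp
  have "((x + y) / (a + b)) powr p \<le> a / (a + b) * (x / a) powr p + b / (a + b) * (y / b) powr p"
  proof (cases "x = 0 \<or> y = 0")
    case False
    then have xy: "x / a \<in> {0<..}" "y / b \<in> {0<..}" using assms by auto
    define t where "t = b / (a + b)"
    have t: "0 \<le> t" "t \<le> 1" "a / (a + b) = 1 - t" using assms by (auto simp: t_def field_simps)
    have "(x + y) / (a + b) = (1 - t) * (x / a) + t * (y / b)"
      unfolding t(3)[symmetric] using assms by (simp add: t_def add_divide_distrib)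
    then show ?thesis
      using convex_onD[OF powr_convex[OF \<open>1 \<le> p\<close>] t(1,2) xy] unfolding t(3) t_def[symmetric] by simp
  next
    \<comment> \<open>\<open>powr_convex\<close> concerns the open half-line, so a vanishing term is
      treated by hand: a weight in \<open>[0, 1]\<close> does not increase when raised to the power
      \<open>p\<close>.\<close>
    case True
    have *: "(z / (a + b)) powr p \<le> c / (a + b) * (z / c) powr p" if "0 < c" "c \<le> a + b" "0 \<le> z" for c z
    proof -
      have "(z / (a + b)) powr p = (c / (a + b)) powr p * (z / c) powr p"
        using that assms by (subst powr_mult[symmetric]) auto
      also have "\<dots> \<le> c / (a + b) * (z / c) powr p"
        using that assms by (intro mult_right_mono one) auto
      finally show ?thesis .
    qed
    from True show ?thesis
    proof
      assume "x = 0"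
      then show ?thesis using *[of b y] assms by simp
    next
      assume "y = 0"
      then show ?thesis using *[of a x] assms by simp
    qed
  qed
  then have "(a + b) powr p * ((x + y) / (a + b)) powr p
      \<le> (a + b) powr p * (a / (a + b) * (x / a) powr p + b / (a + b) * (y / b) powr p)"
    by (intro mult_left_mono) auto
  then show ?thesis using assms by (simp add: powr_divide)
qed

text \<open>Phrased through bounds \<open>a powr p\<close> on the integrals, so that no roots of
  possibly infinite integrals occur.\<close>

lemma nn_integral_Minkowski:
  fixes f g :: "'a \<Rightarrow> complex"
  assumes "1 \<le> p" and [measurable]: "f \<in> borel_measurable M" "g \<in> borel_measurable M" "A \<in> sets M"
    and "0 \<le> a" "0 \<le> b"
    and f: "(\<integral>\<^sup>+x\<in>A. ennreal (cmod (f x) powr p) \<partial>M) \<le> ennreal (a powr p)"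
    and g: "(\<integral>\<^sup>+x\<in>A. ennreal (cmod (g x) powr p) \<partial>M) \<le> ennreal (b powr p)"
  shows "(\<integral>\<^sup>+x\<in>A. ennreal (cmod (f x + g x) powr p) \<partial>M) \<le> ennreal ((a + b) powr p)"
proof -
  \<comment> \<open>The weights divide by the two bounds, which may be 0. Hence positive
    \<open>c\<close> and \<open>d\<close> above them, which finally tend to \<open>a\<close> and
    \<open>b\<close>.\<close>
  have pos: "(\<integral>\<^sup>+x\<in>A. ennreal (cmod (f x + g x) powr p) \<partial>M) \<le> ennreal ((c + d) powr p)"
    if "a \<le> c" "b \<le> d" "0 < c" "0 < d" for c d
  proof -
    have cI: "(\<integral>\<^sup>+x\<in>A. ennreal (cmod (f x) powr p) \<partial>M) \<le> ennreal (c powr p)"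
      by (rule order_trans[OF f]) (use that assms in \<open>auto intro!: ennreal_leI powr_mono2\<close>)
    have dI: "(\<integral>\<^sup>+x\<in>A. ennreal (cmod (g x) powr p) \<partial>M) \<le> ennreal (d powr p)"
      by (rule order_trans[OF g]) (use that assms in \<open>auto intro!: ennreal_leI powr_mono2\<close>)
    define \<alpha> where "\<alpha> = (c + d) powr p * (c / (c + d)) / c powr p"
    define \<beta> where "\<beta> = (c + d) powr p * (d / (c + d)) / d powr p"
    have nn: "0 \<le> \<alpha>" "0 \<le> \<beta>" using that by (auto simp: \<alpha>_def \<beta>_def)
    have "cmod (f x + g x) powr p \<le> \<alpha> * cmod (f x) powr p + \<beta> * cmod (g x) powr p" for x
    proof -
      have "cmod (f x + g x) powr p \<le> (cmod (f x) + cmod (g x)) powr p"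
        using assms by (intro powr_mono2 norm_triangle_ineq) auto
      also have "\<dots> \<le> \<alpha> * cmod (f x) powr p + \<beta> * cmod (g x) powr p"
        using powr_add_le_convex[OF \<open>1 \<le> p\<close> that(3,4), of "cmod (f x)" "cmod (g x)"] that
        by (simp add: \<alpha>_def \<beta>_def powr_divide distrib_left)
      finally show ?thesis .
    qed
    then have "(\<integral>\<^sup>+x\<in>A. ennreal (cmod (f x + g x) powr p) \<partial>M)
        \<le> (\<integral>\<^sup>+x. ennreal \<alpha> * (ennreal (cmod (f x) powr p) * indicator A x)
            + ennreal \<beta> * (ennreal (cmod (g x) powr p) * indicator A x) \<partial>M)"
      using nn by (intro nn_integral_mono)
        (auto simp: indicator_def ennreal_mult[symmetric] ennreal_plus[symmetric] simp del: ennreal_plus intro!: ennreal_leI)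
    also have "\<dots> = ennreal \<alpha> * (\<integral>\<^sup>+x\<in>A. ennreal (cmod (f x) powr p) \<partial>M)
        + ennreal \<beta> * (\<integral>\<^sup>+x\<in>A. ennreal (cmod (g x) powr p) \<partial>M)"
      by (simp add: nn_integral_add nn_integral_cmult)
    also have "\<dots> \<le> ennreal \<alpha> * ennreal (c powr p) + ennreal \<beta> * ennreal (d powr p)"
      by (intro add_mono mult_left_mono cI dI) auto
    also have "\<dots> = ennreal (\<alpha> * c powr p + \<beta> * d powr p)"
      using nn by (simp add: ennreal_mult ennreal_plus)
    also have "\<alpha> * c powr p + \<beta> * d powr p = (c + d) powr p"
    proof -
      have "\<alpha> * c powr p + \<beta> * d powr p = (c + d) powr p * (c / (c + d) + d / (c + d))"
        using that by (simp add: \<alpha>_def \<beta>_def distrib_left)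
      also have "c / (c + d) + d / (c + d) = 1"
        using that by (simp add: add_divide_distrib[symmetric])
      finally show ?thesis by simp
    qed
    finally show ?thesis .
  qed
  have "(\<lambda>n. ennreal (((a + inverse (real (Suc n))) + (b + inverse (real (Suc n)))) powr p))
      \<longlonglongrightarrow> ennreal (((a + 0) + (b + 0)) powr p)"
    using assms by (intro tendsto_ennrealI tendsto_powr' tendsto_intros LIMSEQ_inverse_real_of_nat) auto
  then have "(\<lambda>n. ennreal (((a + inverse (real (Suc n))) + (b + inverse (real (Suc n)))) powr p))
      \<longlonglongrightarrow> ennreal ((a + b) powr p)"
    by (simp only: add_0_right)
  then show ?thesis
  proof (rule LIMSEQ_le_const)
    show "\<exists>N. \<forall>n\<ge>N. (\<integral>\<^sup>+x\<in>A. ennreal (cmod (f x + g x) powr p) \<partial>M)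
        \<le> ennreal (((a + inverse (real (Suc n))) + (b + inverse (real (Suc n)))) powr p)"
      using assms by (intro exI allI impI pos) (auto simp: add_nonneg_pos)
  qed
qed

subsection \<open>Spaces given by families of measures\<close>

definition power_integral :: "real \<Rightarrow> complex measure \<Rightarrow> complex set \<Rightarrow> (complex \<Rightarrow> complex) \<Rightarrow> ennreal" where
  "power_integral p \<mu> A f = (\<integral>\<^sup>+z\<in>A. ennreal (cmod (f z) powr p) \<partial>\<mu>)"

definition evaluation :: "('i \<Rightarrow> complex) set \<Rightarrow> 'i \<Rightarrow> ('i \<Rightarrow> complex) \<Rightarrow> complex" where
  "evaluation V i f = (if f \<in> V then f i else 0)"

section \<open>Analytic functions on the disc\<close>

lemma cball_subset_disc: "s < 1 \<Longrightarrow> cball 0 s \<subseteq> disc"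
  by (auto simp: disc_def)

lemma compact_subset_disc_cball:
  assumes "compact K" "K \<subseteq> disc"
  obtains s where "0 \<le> s" "s < 1" "K \<subseteq> cball 0 s"
proof (cases "K = {}")
  case True
  then show ?thesis using that[of 0] by simp
next
  case False
  obtain z where z: "z \<in> K" "\<And>w. w \<in> K \<Longrightarrow> cmod w \<le> cmod z"
    using continuous_attains_sup[OF assms(1) False, of cmod] by (auto intro: continuous_intros)
  then show ?thesis using that[of "cmod z"] assms(2) by (auto simp: disc_def subset_iff)
qed

lemma hol_disc_outside: "f \<in> hol_disc \<Longrightarrow> z \<notin> disc \<Longrightarrow> f z = 0"
  by (simp add: hol_disc_def)

lemma hol_disc_zero: "(\<lambda>_. 0) \<in> hol_disc"
  and hol_disc_add: "f \<in> hol_disc \<Longrightarrow> g \<in> hol_disc \<Longrightarrow> (\<lambda>z. f z + g z) \<in> hol_disc"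
  and hol_disc_scale: "f \<in> hol_disc \<Longrightarrow> (\<lambda>z. c * f z) \<in> hol_disc"
  by (auto simp: hol_disc_def intro!: holomorphic_intros)

lemma hol_disc_borel:
  assumes "f \<in> hol_disc"
  shows "f \<in> borel_measurable borel"
proof -
  have "continuous_on disc f"
    using assms by (auto simp: hol_disc_def intro: holomorphic_on_imp_continuous_on)
  then have "(\<lambda>z. indicator disc z *\<^sub>R f z) \<in> borel_measurable borel"
    by (intro borel_measurable_continuous_on_indicator) (auto simp: disc_def)
  also have "(\<lambda>z. indicator disc z *\<^sub>R f z) = f"
    using hol_disc_outside[OF assms] by (auto simp: indicator_def)
  finally show ?thesis .
qed

lemma hol_disc_bounded_cball:
  assumes "f \<in> hol_disc" "s < 1"
  obtains B where "0 \<le> B" "\<And>z. z \<in> cball 0 s \<Longrightarrow> cmod (f z) \<le> B"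
proof -
  have "continuous_on (cball 0 s) f"
    using assms cball_subset_disc[OF assms(2)]
    by (auto simp: hol_disc_def intro: holomorphic_on_imp_continuous_on continuous_on_subset)
  then have "bounded (f ` cball 0 s)"
    by (intro compact_imp_bounded compact_continuous_image) auto
  then obtain B where "B > 0" "\<And>z. z \<in> cball 0 s \<Longrightarrow> cmod (f z) \<le> B"
    unfolding bounded_pos by blast
  then show ?thesis using that[of B] by simp
qed

text \<open>Identity theorem on the points 1/2, 1/3, ..., which accumulate at 0; the shift by 2
  keeps them inside the open disc. A countable set of test points fits
  \<open>goldstine_sequence\<close>.\<close>

lemma hol_disc_eqI:
  assumes f: "f \<in> hol_disc" and g: "g \<in> hol_disc"
    and eq: "\<And>j::nat. f (of_real (inverse (real (j + 2)))) = g (of_real (inverse (real (j + 2))))"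
  shows "f = g"
proof
  fix z
  define w where "w j = complex_of_real (inverse (real (j + 2)))" for j
  show "f z = g z"
  proof (cases "z \<in> disc")
    case True
    have lim: "w \<longlonglongrightarrow> of_real 0"
      unfolding w_def using LIMSEQ_ignore_initial_segment[OF lim_inverse_n, of 2]
      by (intro tendsto_of_real) simp
    have wd: "w j \<in> disc" for j
    proof -
      have "cmod (w j) = inverse (real (j + 2))" unfolding w_def norm_of_real by simp
      moreover have "inverse (real (j + 2)) < 1" by (simp add: field_simps)
      ultimately show ?thesis by (simp add: disc_def)
    qed
    have w0: "w j \<noteq> 0" for j
      unfolding w_def of_real_eq_0_iff inverse_nonzero_iff_nonzero of_nat_eq_0_iff by simp
    have "0 islimpt range w"
      unfolding islimpt_sequential using lim w0 by (intro exI[of _ w]) auto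
    moreover have "f (w j) = g (w j)" for j
      unfolding w_def by (rule eq)
    moreover have "(\<lambda>z. f z - g z) holomorphic_on disc"
      using f g by (auto simp: hol_disc_def intro!: holomorphic_intros)
    moreover have "open disc" "connected disc" "0 \<in> disc" by (auto simp: disc_def)
    ultimately have "f z - g z = 0"
      using wd True by (intro analytic_continuation[of "\<lambda>z. f z - g z" disc "range w" 0 z]) auto
    then show ?thesis by simp
  qed (use f g in \<open>simp add: hol_disc_outside\<close>)
qed

section \<open>Integrals of powers against a measure\<close>

lemma power_integral_mono_set: "A \<subseteq> B \<Longrightarrow> power_integral p \<mu> A f \<le> power_integral p \<mu> B f"
  unfolding power_integral_def by (intro nn_integral_mono mult_left_mono) (auto simp: indicator_def)

lemma power_integral_scale:
  assumes "sets \<mu> = sets borel" "f \<in> borel_measurable borel" "A \<in> sets borel"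
  shows "power_integral p \<mu> A (\<lambda>z. c * f z) = ennreal (cmod c powr p) * power_integral p \<mu> A f"
proof -
  note assms(1)[measurable_cong] and assms(2,3)[measurable]
  show ?thesis
    unfolding power_integral_def
    by (subst nn_integral_cmult[symmetric], measurable)
       (simp add: norm_mult powr_mult ennreal_mult mult.assoc)
qed

lemma power_integral_split:
  assumes "sets \<mu> = sets borel" "f \<in> borel_measurable borel" "A \<in> sets borel"
  shows "power_integral p \<mu> UNIV f = power_integral p \<mu> A f + power_integral p \<mu> (- A) f"
proof -
  note assms(1)[measurable_cong] and assms(2,3)[measurable]
  have "power_integral p \<mu> A f + power_integral p \<mu> (- A) f
      = (\<integral>\<^sup>+z. ennreal (cmod (f z) powr p) * indicator A z + ennreal (cmod (f z) powr p) * indicator (- A) z \<partial>\<mu>)"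
    unfolding power_integral_def by (rule nn_integral_add[symmetric]; measurable)
  also have "\<dots> = power_integral p \<mu> UNIV f"
    unfolding power_integral_def by (intro nn_integral_cong) (auto simp: indicator_def)
  finally show ?thesis by simp
qed

lemma power_integral_le_const:
  assumes "sets \<mu> = sets borel" "emeasure \<mu> UNIV \<le> 1" "0 \<le> p" "\<And>z. z \<in> A \<Longrightarrow> cmod (f z) \<le> b"
  shows "power_integral p \<mu> A f \<le> ennreal (b powr p)"
proof -
  have "power_integral p \<mu> A f \<le> (\<integral>\<^sup>+z. ennreal (b powr p) \<partial>\<mu>)"
    unfolding power_integral_def using assms
    by (intro nn_integral_mono) (auto simp: indicator_def intro!: ennreal_leI powr_mono2)
  also have "\<dots> \<le> ennreal (b powr p) * 1"
    using assms(2) sets_eq_imp_space_eq[OF assms(1)] by (simp add: mult_left_le)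
  finally show ?thesis by simp
qed

lemma power_integral_add_le:
  assumes "1 \<le> p" "sets \<mu> = sets borel" "f \<in> borel_measurable borel" "g \<in> borel_measurable borel"
    "A \<in> sets borel" "0 \<le> a" "0 \<le> b"
    "power_integral p \<mu> A f \<le> ennreal (a powr p)" "power_integral p \<mu> A g \<le> ennreal (b powr p)"
  shows "power_integral p \<mu> A (\<lambda>z. f z + g z) \<le> ennreal ((a + b) powr p)"
proof -
  note assms(2)[measurable_cong] and assms(3-5)[measurable]
  show ?thesis
    using assms unfolding power_integral_def by (intro nn_integral_Minkowski) (auto simp: measurable_cong_sets[OF assms(2) refl])
qed

lemma uniform_limit_imp_pointwise_disc:
  assumes "\<And>K. compact K \<Longrightarrow> K \<subseteq> disc \<Longrightarrow> uniform_limit K f g sequentially" "z \<in> disc"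
  shows "(\<lambda>n::nat. f n z) \<longlonglongrightarrow> g z"
  by (rule tendsto_uniform_limitI[OF assms(1)[of "{z}"]]) (use assms(2) in auto)

text \<open>
  A single averaged measure gives the Bergman space, with \<open>X = Y\<close>; the measures on the radii give the
  pair \<open>X = RM(p,0)\<close>, \<open>Y = RM(p,\<infinity>)\<close>.
\<close>
locale radial_space =
  fixes p :: real and X Y :: "(complex \<Rightarrow> complex) set" and N :: "(complex \<Rightarrow> complex) \<Rightarrow> real"
    and \<M> :: "complex measure set"
  assumes p: "1 < p"
    and sets_\<M>: "\<mu> \<in> \<M> \<Longrightarrow> sets \<mu> = sets borel"
    and mass_\<M>: "\<mu> \<in> \<M> \<Longrightarrow> emeasure \<mu> UNIV \<le> 1"
    and Y_iff: "f \<in> Y \<longleftrightarrow> f \<in> hol_disc \<and> (\<exists>a\<ge>0. \<forall>\<mu>\<in>\<M>. power_integral p \<mu> UNIV f \<le> ennreal (a powr p))"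
    and X_iff: "f \<in> X \<longleftrightarrow> f \<in> hol_disc \<and>
      (\<forall>e>0. \<exists>s\<in>{0..<1}. \<forall>\<mu>\<in>\<M>. power_integral p \<mu> (- cball 0 s) f \<le> ennreal (e powr p))"
    and N_nonneg: "0 \<le> N f"
    and N_le_iff: "f \<in> Y \<Longrightarrow> 0 \<le> a \<Longrightarrow> N f \<le> a \<longleftrightarrow> (\<forall>\<mu>\<in>\<M>. power_integral p \<mu> UNIV f \<le> ennreal (a powr p))"
    and local_bound: "0 \<le> s \<Longrightarrow> s < 1 \<Longrightarrow> \<exists>C. \<forall>f\<in>Y. N f \<le> 1 \<longrightarrow> (\<forall>z\<in>cball 0 s. cmod (f z) \<le> C)"
    and approx: "g \<in> Y \<Longrightarrow> \<exists>h c. (\<forall>n::nat. h n \<in> X \<and> N (h n) \<le> c n * N g) \<and> c \<longlonglongrightarrow> 1 \<and>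
      (\<forall>K. compact K \<longrightarrow> K \<subseteq> disc \<longrightarrow> uniform_limit K h g sequentially)"
begin

lemma Y_hol: "f \<in> Y \<Longrightarrow> f \<in> hol_disc"
  and X_hol: "f \<in> X \<Longrightarrow> f \<in> hol_disc"
  by (simp_all add: Y_iff X_iff)

lemma power_integral_N: "f \<in> Y \<Longrightarrow> \<mu> \<in> \<M> \<Longrightarrow> power_integral p \<mu> UNIV f \<le> ennreal (N f powr p)"
  using N_le_iff[of f "N f"] N_nonneg[of f] by simp

lemma Y_N_leI:
  assumes "f \<in> hol_disc" "0 \<le> a" "\<And>\<mu>. \<mu> \<in> \<M> \<Longrightarrow> power_integral p \<mu> UNIV f \<le> ennreal (a powr p)"
  shows "f \<in> Y" "N f \<le> a"
proof -
  show "f \<in> Y" using assms by (auto simp: Y_iff)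
  then show "N f \<le> a" using assms by (simp add: N_le_iff)
qed

text \<open>Outside a suitable disc the integrals are at most 1 for all measures at once; inside it
  \<open>f\<close> is bounded and the masses are at most 1.\<close>

lemma X_subset_Y: "f \<in> X \<Longrightarrow> f \<in> Y"
proof -
  assume f: "f \<in> X"
  then obtain s where s: "0 \<le> s" "s < 1" "\<And>\<mu>. \<mu> \<in> \<M> \<Longrightarrow> power_integral p \<mu> (- cball 0 s) f \<le> ennreal (1 powr p)"
    unfolding X_iff by (metis atLeastLessThan_iff zero_less_one)
  obtain B where B: "0 \<le> B" "\<And>z. z \<in> cball 0 s \<Longrightarrow> cmod (f z) \<le> B"
    by (rule hol_disc_bounded_cball[OF X_hol[OF f] s(2)]) blast
  have "power_integral p \<mu> UNIV f \<le> ennreal (((B powr p + 1) powr (1 / p)) powr p)" if "\<mu> \<in> \<M>" for \<mu>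
  proof -
    have "power_integral p \<mu> UNIV f = power_integral p \<mu> (cball 0 s) f + power_integral p \<mu> (- cball 0 s) f"
      using f by (intro power_integral_split sets_\<M> that hol_disc_borel X_hol) auto
    also have "\<dots> \<le> ennreal (B powr p) + ennreal (1 powr p)"
      using p B that by (intro add_mono s power_integral_le_const sets_\<M> mass_\<M>) auto
    also have "\<dots> = ennreal (((B powr p + 1) powr (1 / p)) powr p)"
      using p by (simp add: powr_powr add_nonneg_pos)
    finally show ?thesis .
  qed
  then show "f \<in> Y" by (rule Y_N_leI(1)[OF X_hol[OF f] powr_ge_zero])
qed

lemma Y_add:
  assumes "f \<in> Y" "g \<in> Y"
  shows "(\<lambda>z. f z + g z) \<in> Y" "N (\<lambda>z. f z + g z) \<le> N f + N g"
proof -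
  have "power_integral p \<mu> UNIV (\<lambda>z. f z + g z) \<le> ennreal ((N f + N g) powr p)" if "\<mu> \<in> \<M>" for \<mu>
    using p assms that
    by (intro power_integral_add_le sets_\<M> hol_disc_borel Y_hol N_nonneg power_integral_N) auto
  then show "(\<lambda>z. f z + g z) \<in> Y" "N (\<lambda>z. f z + g z) \<le> N f + N g"
    using Y_N_leI[OF hol_disc_add[OF assms[THEN Y_hol]], of "N f + N g"] N_nonneg[of f] N_nonneg[of g] by auto
qed

lemma Y_scale:
  assumes "f \<in> Y"
  shows "(\<lambda>z. c * f z) \<in> Y" "N (\<lambda>z. c * f z) = cmod c * N f"
proof -
  have *: "(\<lambda>z. c * f z) \<in> Y \<and> N (\<lambda>z. c * f z) \<le> cmod c * N f" if "f \<in> Y" for c f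
  proof -
    have "power_integral p \<mu> UNIV (\<lambda>z. c * f z) \<le> ennreal ((cmod c * N f) powr p)" if "\<mu> \<in> \<M>" for \<mu>
    proof -
      have "power_integral p \<mu> UNIV (\<lambda>z. c * f z) = ennreal (cmod c powr p) * power_integral p \<mu> UNIV f"
        using that \<open>f \<in> Y\<close> by (intro power_integral_scale sets_\<M> hol_disc_borel Y_hol) auto
      also have "\<dots> \<le> ennreal (cmod c powr p) * ennreal (N f powr p)"
        by (intro mult_left_mono power_integral_N that \<open>f \<in> Y\<close>) auto
      finally show ?thesis by (simp add: powr_mult N_nonneg ennreal_mult)
    qed
    then show ?thesis
      using Y_N_leI[OF hol_disc_scale[OF Y_hol[OF that]], of "cmod c * N f" c] N_nonneg[of f] by auto
  qed
  show mem: "(\<lambda>z. c * f z) \<in> Y" using *[OF assms] by simp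
  show "N (\<lambda>z. c * f z) = cmod c * N f"
  proof (cases "c = 0")
    case True
    then show ?thesis using *[OF assms, of c] N_nonneg[of "\<lambda>z. 0"] by simp
  next
    case False
    then have "N f \<le> cmod (1 / c) * N (\<lambda>z. c * f z)"
      using *[OF mem, of "1 / c"] by simp
    then have "cmod c * N f \<le> N (\<lambda>z. c * f z)"
      using False by (simp add: norm_divide field_simps)
    then show ?thesis using *[OF assms, of c] by simp
  qed
qed

text \<open>\<open>local_bound\<close> made homogeneous. The case \<open>N f = 0\<close> is not
  trivial here, because \<open>N_definite\<close> is derived from this lemma.\<close>

lemma pointwise_bound:
  assumes "0 \<le> s" "s < 1"
  obtains C where "0 \<le> C" "\<And>f z. f \<in> Y \<Longrightarrow> z \<in> cball 0 s \<Longrightarrow> cmod (f z) \<le> C * N f"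
proof -
  obtain C where C: "\<And>f z. f \<in> Y \<Longrightarrow> N f \<le> 1 \<Longrightarrow> z \<in> cball 0 s \<Longrightarrow> cmod (f z) \<le> C"
    using local_bound[OF assms] by blast
  have "cmod (f z) \<le> max C 0 * N f" if f: "f \<in> Y" and z: "z \<in> cball 0 s" for f z
  proof (cases "N f = 0")
    case True
    \<comment> \<open>All integer multiples of \<open>f\<close> have norm 0 and are therefore
      bounded by the same \<open>C\<close>.\<close>
    have "real k * cmod (f z) \<le> C" for k
      using C[OF Y_scale(1)[OF f] _ z, of "of_nat k"] True by (simp add: Y_scale(2)[OF f] norm_mult)
    then have "cmod (f z) = 0"
      by (metis mult.commute norm_le_zero_iff norm_zero reals_Archimedean3 not_le linorder_not_less)
    then show ?thesis using True by simp
  next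
    case False
    then have pos: "N f > 0" using N_nonneg[of f] by simp
    have "cmod (of_real (1 / N f) * f z) \<le> C"
    proof (rule C[OF Y_scale(1)[OF f] _ z])
      show "N (\<lambda>z. of_real (1 / N f) * f z) \<le> 1"
        unfolding Y_scale(2)[OF f] using pos by (simp add: norm_divide)
    qed
    then have "cmod (f z) \<le> C * N f" using pos by (simp add: norm_mult norm_divide field_simps)
    also have "\<dots> \<le> max C 0 * N f" using pos by (intro mult_right_mono) auto
    finally show ?thesis .
  qed
  then show ?thesis by (intro that[of "max C 0"]) auto
qed

lemma N_definite: "f \<in> Y \<Longrightarrow> N f = 0 \<Longrightarrow> f z = 0"
proof (cases "z \<in> disc")
  case True
  assume f: "f \<in> Y" "N f = 0"
  obtain C where "0 \<le> C" "\<And>f w. f \<in> Y \<Longrightarrow> w \<in> cball 0 (cmod z) \<Longrightarrow> cmod (f w) \<le> C * N f"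
    using pointwise_bound[of "cmod z"] True by (auto simp: disc_def)
  from this(2)[OF f(1), of z] f(2) show ?thesis by simp
qed (simp add: hol_disc_outside Y_hol)

lemma normed_functions_Y: "normed_functions Y N"
proof
  show "(\<lambda>_. 0) \<in> Y"
    using Y_N_leI(1)[OF hol_disc_zero, of 0] p by (simp add: power_integral_def)
qed (use Y_add Y_scale N_nonneg N_definite in auto)

lemma X_zero: "(\<lambda>_. 0) \<in> X"
  using p by (auto simp: X_iff hol_disc_zero power_integral_def intro!: bexI[of _ 0])

lemma X_add:
  assumes "f \<in> X" "g \<in> X"
  shows "(\<lambda>z. f z + g z) \<in> X"
  unfolding X_iff
proof (intro conjI allI impI)
  show "(\<lambda>z. f z + g z) \<in> hol_disc" using assms by (intro hol_disc_add X_hol)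
  fix e :: real assume "0 < e"
  then obtain s t where s: "s \<in> {0..<1}" "\<And>\<mu>. \<mu> \<in> \<M> \<Longrightarrow> power_integral p \<mu> (- cball 0 s) f \<le> ennreal ((e / 2) powr p)"
    and t: "t \<in> {0..<1}" "\<And>\<mu>. \<mu> \<in> \<M> \<Longrightarrow> power_integral p \<mu> (- cball 0 t) g \<le> ennreal ((e / 2) powr p)"
    using assms unfolding X_iff by (meson half_gt_zero)
  have "power_integral p \<mu> (- cball 0 (max s t)) (\<lambda>z. f z + g z) \<le> ennreal ((e / 2 + e / 2) powr p)" if \<mu>: "\<mu> \<in> \<M>" for \<mu>
  proof (rule power_integral_add_le)
    show "power_integral p \<mu> (- cball 0 (max s t)) f \<le> ennreal ((e / 2) powr p)"
      by (rule order_trans[OF power_integral_mono_set s(2)[OF \<mu>]]) auto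
    show "power_integral p \<mu> (- cball 0 (max s t)) g \<le> ennreal ((e / 2) powr p)"
      by (rule order_trans[OF power_integral_mono_set t(2)[OF \<mu>]]) auto
  qed (use p assms \<mu> \<open>0 < e\<close> in \<open>simp_all add: sets_\<M> hol_disc_borel X_hol\<close>)
  then show "\<exists>s\<in>{0..<1}. \<forall>\<mu>\<in>\<M>. power_integral p \<mu> (- cball 0 s) (\<lambda>z. f z + g z) \<le> ennreal (e powr p)"
    using s(1) t(1) by (intro bexI[of _ "max s t"]) auto
qed

lemma X_scale:
  assumes "f \<in> X"
  shows "(\<lambda>z. c * f z) \<in> X"
proof (cases "c = 0")
  case True
  then show ?thesis using X_zero by simp
next
  case False
  show ?thesis
    unfolding X_iff
  proof (intro conjI allI impI)
    show "(\<lambda>z. c * f z) \<in> hol_disc" using assms by (intro hol_disc_scale X_hol)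
    fix e :: real assume "0 < e"
    then obtain s where s: "s \<in> {0..<1}" "\<And>\<mu>. \<mu> \<in> \<M> \<Longrightarrow> power_integral p \<mu> (- cball 0 s) f \<le> ennreal ((e / cmod c) powr p)"
      using assms False unfolding X_iff by (meson divide_pos_pos zero_less_norm_iff)
    have "power_integral p \<mu> (- cball 0 s) (\<lambda>z. c * f z) \<le> ennreal (e powr p)" if \<mu>: "\<mu> \<in> \<M>" for \<mu>
    proof -
      have "power_integral p \<mu> (- cball 0 s) (\<lambda>z. c * f z) = ennreal (cmod c powr p) * power_integral p \<mu> (- cball 0 s) f"
        using \<mu> assms by (intro power_integral_scale sets_\<M> hol_disc_borel X_hol) auto
      also have "\<dots> \<le> ennreal (cmod c powr p) * ennreal ((e / cmod c) powr p)"
        by (intro mult_left_mono s \<mu>) auto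
      also have "\<dots> = ennreal (e powr p)"
        using False \<open>0 < e\<close> by (simp add: ennreal_mult[symmetric] powr_divide)
      finally show ?thesis .
    qed
    then show "\<exists>s\<in>{0..<1}. \<forall>\<mu>\<in>\<M>. power_integral p \<mu> (- cball 0 s) (\<lambda>z. c * f z) \<le> ennreal (e powr p)"
      using s(1) by blast
  qed
qed

end

sublocale radial_space \<subseteq> Y: normed_functions Y N
  by (rule normed_functions_Y)

sublocale radial_space \<subseteq> X: normed_functions X N
  by standard (use X_zero X_add X_scale Y_add Y_scale N_nonneg N_definite X_subset_Y in auto)

subsection \<open>Gliding humps and normal families\<close>

context radial_space
begin

text \<open>
  One step of a gliding hump: once \<open>n\<close> is large, \<open>f n\<close> lives where \<open>F\<close> is negligible, so the
  \<open>p\<close>-th powers of the norms add up to within 1.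
\<close>
lemma almost_disjoint_add:
  assumes F: "F \<in> X" "0 \<le> A" "\<And>\<mu>. \<mu> \<in> \<M> \<Longrightarrow> power_integral p \<mu> UNIV F \<le> ennreal A"
    and f: "\<And>n::nat. f n \<in> Y" "\<And>n. N (f n) \<le> b"
    and lim: "\<And>K. compact K \<Longrightarrow> K \<subseteq> disc \<Longrightarrow> uniform_limit K f (\<lambda>_. 0) sequentially"
  obtains n0 where "\<And>n \<mu>. n0 \<le> n \<Longrightarrow> \<mu> \<in> \<M> \<Longrightarrow>
    power_integral p \<mu> UNIV (\<lambda>z. F z + f n z) \<le> ennreal (A + b powr p + 1)"
proof -
  have b: "0 \<le> b" using f(2)[of 0] N_nonneg[of "f 0"] by simp
  \<comment> \<open>The two summands will bound the integral inside \<open>cball 0 s\<close>, where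
    \<open>f n\<close> is below \<eta>, and outside it, where the tail of \<open>F\<close> is at
    most \<open>\<eta> powr p\<close>. As \<eta> tends to 0 they tend to
    \<open>A + b powr p\<close>, so some positive \<eta> costs less than 1.\<close>
  have "((\<lambda>\<eta>. (A powr (1 / p) + \<eta>) powr p + (\<eta> + b) powr p) \<longlongrightarrow> (A powr (1 / p) + 0) powr p + (0 + b) powr p)
      (at_right 0)"
    using p b by (intro tendsto_intros tendsto_powr') (auto simp: eventually_at_filter)
  then have "((\<lambda>\<eta>. (A powr (1 / p) + \<eta>) powr p + (\<eta> + b) powr p) \<longlongrightarrow> A + b powr p) (at_right 0)"
    using p F(2) by (simp add: powr_powr)
  then have "\<forall>\<^sub>F \<eta> in at_right 0. (A powr (1 / p) + \<eta>) powr p + (\<eta> + b) powr p < A + b powr p + 1"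
    by (rule order_tendstoD) simp
  then have "\<forall>\<^sub>F \<eta> in at_right 0. \<eta> > 0 \<and> (A powr (1 / p) + \<eta>) powr p + (\<eta> + b) powr p < A + b powr p + 1"
    using eventually_at_right_less[of "0::real"] by eventually_elim auto
  then obtain \<eta> where \<eta>: "0 < \<eta>" "(A powr (1 / p) + \<eta>) powr p + (\<eta> + b) powr p < A + b powr p + 1"
    using eventually_happens[of _ "at_right (0::real)"] trivial_limit_at_right_real by blast
  \<comment> \<open>First the radius from the tail of \<open>F\<close>, then the index from uniform
    convergence on that disc; both serve every \<mu>.\<close>
  obtain s where s: "0 \<le> s" "s < 1"
    "\<And>\<mu>. \<mu> \<in> \<M> \<Longrightarrow> power_integral p \<mu> (- cball 0 s) F \<le> ennreal (\<eta> powr p)"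
    using F(1) \<eta>(1) unfolding X_iff by (metis atLeastLessThan_iff)
  have "uniform_limit (cball 0 s) f (\<lambda>_. 0) sequentially"
    by (intro lim compact_cball cball_subset_disc s)
  from uniform_limitD[OF this \<eta>(1)] obtain n0 where n0: "\<And>n z. n0 \<le> n \<Longrightarrow> z \<in> cball 0 s \<Longrightarrow> cmod (f n z) < \<eta>"
    unfolding eventually_sequentially dist_norm diff_0_right by blast
  show thesis
  proof (rule that[of n0])
    fix n \<mu> assume n: "n0 \<le> n" and \<mu>: "\<mu> \<in> \<M>"
    note meas = sets_\<M>[OF \<mu>] hol_disc_borel[OF X_hol[OF F(1)]] hol_disc_borel[OF Y_hol[OF f(1)[of n]]]
    have "power_integral p \<mu> UNIV (\<lambda>z. F z + f n z) = power_integral p \<mu> (cball 0 s) (\<lambda>z. F z + f n z)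
        + power_integral p \<mu> (- cball 0 s) (\<lambda>z. F z + f n z)"
      using meas by (intro power_integral_split) auto
    also have "power_integral p \<mu> (cball 0 s) (\<lambda>z. F z + f n z) \<le> ennreal ((A powr (1 / p) + \<eta>) powr p)"
    proof (rule power_integral_add_le)
      show "power_integral p \<mu> (cball 0 s) F \<le> ennreal ((A powr (1 / p)) powr p)"
        using order_trans[OF power_integral_mono_set F(3)[OF \<mu>]] p F(2) by (simp add: powr_powr)
      show "power_integral p \<mu> (cball 0 s) (f n) \<le> ennreal (\<eta> powr p)"
        using p n0[OF n] by (intro power_integral_le_const meas mass_\<M> \<mu>) (auto intro: less_imp_le)
    qed (use p meas \<eta> in auto)
    also have "power_integral p \<mu> (- cball 0 s) (\<lambda>z. F z + f n z) \<le> ennreal ((\<eta> + b) powr p)"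
    proof (rule power_integral_add_le)
      have "power_integral p \<mu> UNIV (f n) \<le> ennreal (b powr p)"
        using N_le_iff[OF f(1) b] f(2) \<mu> by blast
      then show "power_integral p \<mu> (- cball 0 s) (f n) \<le> ennreal (b powr p)"
        using order_trans[OF power_integral_mono_set] by blast
    qed (use p meas \<eta> b s \<mu> in auto)
    also have "ennreal ((A powr (1 / p) + \<eta>) powr p) + ennreal ((\<eta> + b) powr p)
        \<le> ennreal (A + b powr p + 1)"
      using \<eta>(2) by (simp add: ennreal_plus[symmetric] ennreal_leI del: ennreal_plus)
    finally show "power_integral p \<mu> UNIV (\<lambda>z. F z + f n z) \<le> ennreal (A + b powr p + 1)"
      by (auto intro: add_mono)
  qed
qed

text \<open>
  Otherwise \<open>k\<close> almost disjoint humps give an element of norm \<open>O(k powr (1 / p))\<close> at which \<open>\<phi>\<close> is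
  at least \<open>k * \<delta>\<close>; this is where \<open>p > 1\<close> enters.
\<close>
lemma dual_tendsto_zero:
  assumes \<phi>: "\<phi> \<in> dual_space X N"
    and f: "\<And>n::nat. f n \<in> X" "\<And>n. N (f n) \<le> b"
    and lim: "\<And>K. compact K \<Longrightarrow> K \<subseteq> disc \<Longrightarrow> uniform_limit K f (\<lambda>_. 0) sequentially"
  shows "(\<lambda>n. \<phi> (f n)) \<longlonglongrightarrow> 0"
proof (rule ccontr)
  assume "\<not> (\<lambda>n. \<phi> (f n)) \<longlonglongrightarrow> 0"
  then obtain \<delta> where \<delta>: "0 < \<delta>" "\<And>n0. \<exists>n\<ge>n0. \<delta> \<le> cmod (\<phi> (f n))"
    unfolding lim_sequentially by (auto simp: not_less)
  have b: "0 \<le> b" using f(2)[of 0] N_nonneg[of "f 0"] by simp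
  \<comment> \<open>The cost of one hump: \<open>b powr p\<close>, plus the 1 lost in
    \<open>almost_disjoint_add\<close>.\<close>
  define B where "B = b powr p + 1"
  have B: "0 < B" by (simp add: B_def add_nonneg_pos)
  have humps: "\<exists>F\<in>X. real k * \<delta> \<le> Re (\<phi> F) \<and> (\<forall>\<mu>\<in>\<M>. power_integral p \<mu> UNIV F \<le> ennreal (real k * B))" for k
  proof (induction k)
    case 0
    then show ?case
      using X_zero X.dual_zero[OF \<phi>] p by (intro bexI[of _ "\<lambda>_. 0"]) (simp_all add: power_integral_def)
  next
    case (Suc k)
    then obtain F where F: "F \<in> X" "real k * \<delta> \<le> Re (\<phi> F)"
      "\<And>\<mu>. \<mu> \<in> \<M> \<Longrightarrow> power_integral p \<mu> UNIV F \<le> ennreal (real k * B)" by blast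
    \<comment> \<open>Unimodular factors make the contributions to \<phi> real and nonnegative, so
      that they add up without cancellation.\<close>
    define c where "c n = (if \<phi> (f n) = 0 then 1 else cnj (\<phi> (f n)) / cmod (\<phi> (f n)))" for n
    have c: "cmod (c n) = 1" "c n * \<phi> (f n) = cmod (\<phi> (f n))" for n
      by (auto simp: c_def norm_divide complex_norm_square[symmetric] power2_eq_square mult.commute field_simps)
    have lim': "uniform_limit K (\<lambda>n z. c n * f n z) (\<lambda>_. 0) sequentially" if "compact K" "K \<subseteq> disc" for K
      using lim[OF that] unfolding uniform_limit_iff by (simp add: norm_mult c(1))
    obtain n0 where n0: "\<And>n \<mu>. n0 \<le> n \<Longrightarrow> \<mu> \<in> \<M> \<Longrightarrow>
        power_integral p \<mu> UNIV (\<lambda>z. F z + c n * f n z) \<le> ennreal (real k * B + b powr p + 1)"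
    proof (rule almost_disjoint_add[of F "real k * B" "\<lambda>n z. c n * f n z" b])
      show "(\<lambda>z. c n * f n z) \<in> Y" "N (\<lambda>z. c n * f n z) \<le> b" for n
        using f by (simp_all add: Y_scale X_subset_Y c(1))
    qed (use F B lim' in auto)
    obtain n where n: "n0 \<le> n" "\<delta> \<le> cmod (\<phi> (f n))" using \<delta>(2) by blast
    have "\<phi> (\<lambda>z. F z + c n * f n z) = \<phi> F + cmod (\<phi> (f n))"
      by (simp add: X.dual_add[OF \<phi> F(1) X_scale[OF f(1)]] X.dual_scale[OF \<phi> f(1)] c(2))
    then have "real (Suc k) * \<delta> \<le> Re (\<phi> (\<lambda>z. F z + c n * f n z))"
      using F(2) n(2) by (simp add: algebra_simps)
    moreover have "power_integral p \<mu> UNIV (\<lambda>z. F z + c n * f n z) \<le> ennreal (real (Suc k) * B)" if "\<mu> \<in> \<M>" for \<mu>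
      using n0[OF n(1) that] by (simp add: B_def algebra_simps)
    ultimately show ?case using X_add[OF F(1) X_scale[OF f(1)]] by blast
  qed
  define D where "D = dual_norm X N \<phi> * B powr (1 / p) / \<delta>"
  \<comment> \<open>Comparing \<open>k * \<delta>\<close> with the norm bound
    \<open>(k * B) powr (1 / p)\<close> leaves a positive power of \<open>k\<close> bounded by a
    constant.\<close>
  have growth: "real k powr (1 - 1 / p) \<le> D" if "0 < k" for k
  proof -
    obtain F where F: "F \<in> X" "real k * \<delta> \<le> Re (\<phi> F)"
      "\<And>\<mu>. \<mu> \<in> \<M> \<Longrightarrow> power_integral p \<mu> UNIV F \<le> ennreal (real k * B)" using humps by blast
    have "N F \<le> (real k * B) powr (1 / p)"
      using F B p by (intro Y_N_leI X_hol) (auto simp: powr_powr)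
    then have "dual_norm X N \<phi> * N F \<le> dual_norm X N \<phi> * (real k * B) powr (1 / p)"
      by (intro mult_left_mono X.dual_norm_nonneg \<phi>)
    with F(2) X.dual_bound[OF \<phi> F(1)] complex_Re_le_cmod[of "\<phi> F"]
    have "real k * \<delta> \<le> dual_norm X N \<phi> * (real k * B) powr (1 / p)" by linarith
    then have "real k \<le> D * real k powr (1 / p)"
      using B \<delta>(1) by (simp add: D_def powr_mult field_simps)
    then have "real k / real k powr (1 / p) \<le> D"
      using that by (simp add: divide_le_eq)
    then show ?thesis using that by (simp add: powr_diff)
  qed
  define q where "q = 1 - 1 / p"
  have q: "0 < q" using p by (simp add: q_def)
  obtain k :: nat where k: "(\<bar>D\<bar> + 1) powr (1 / q) < real k" using reals_Archimedean2 by blast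
  have "\<bar>D\<bar> + 1 = ((\<bar>D\<bar> + 1) powr (1 / q)) powr q" using q by (simp add: powr_powr)
  also have "\<dots> \<le> real k powr q" using k q by (intro powr_mono2) auto
  finally have *: "\<bar>D\<bar> + 1 \<le> real k powr q" .
  have "0 < k" using le_less_trans[OF powr_ge_zero k] by simp
  then have "real k powr q \<le> D" using growth unfolding q_def by blast
  with * show False by linarith
qed

text \<open>\<open>pointwise_bound\<close> turns the norm bound into local uniform boundedness, so
  Montel's theorem applies.\<close>

lemma montel_disc:
  assumes f: "\<And>n::nat. f n \<in> Y" "\<And>n. N (f n) \<le> b"
  obtains g r where "g \<in> hol_disc" "strict_mono r"
    "\<And>K. compact K \<Longrightarrow> K \<subseteq> disc \<Longrightarrow> uniform_limit K (\<lambda>n. f (r n)) g sequentially"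
proof -
  have bounded: "\<exists>B. \<forall>h\<in>range f. \<forall>z\<in>K. cmod (h z) \<le> B" if K: "compact K" "K \<subseteq> disc" for K
  proof -
    obtain s where s: "0 \<le> s" "s < 1" "K \<subseteq> cball 0 s"
      using compact_subset_disc_cball[OF K] .
    obtain C where C: "0 \<le> C" "\<And>f z. f \<in> Y \<Longrightarrow> z \<in> cball 0 s \<Longrightarrow> cmod (f z) \<le> C * N f"
      by (rule pointwise_bound[OF s(1,2)]) blast
    have "cmod (f n z) \<le> C * b" if "z \<in> K" for n z
      using C(2)[OF f(1)[of n], of z] mult_left_mono[OF f(2)[of n] C(1)] s(3) that by fastforce
    then show ?thesis by blast
  qed
  obtain g r where g: "g holomorphic_on disc" "strict_mono (r :: nat \<Rightarrow> nat)"
    "\<And>K. compact K \<Longrightarrow> K \<subseteq> disc \<Longrightarrow> uniform_limit K (f \<circ> r) g sequentially"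
  proof (rule Montel[of disc "range f" f])
    show "open disc" by (simp add: disc_def)
    show "h holomorphic_on disc" if "h \<in> range f" for h
      using that Y_hol[OF f(1)] by (auto simp: hol_disc_def)
  qed (use bounded in auto)
  \<comment> \<open>Montel's limit is arbitrary off the disc; \<open>hol_disc\<close> requires the
    value 0 there.\<close>
  define g' where "g' z = (if z \<in> disc then g z else 0)" for z
  show thesis
  proof (rule that[of g' r])
    show "g' \<in> hol_disc"
      using holomorphic_transform[OF g(1), of g'] by (auto simp: hol_disc_def g'_def)
    show "uniform_limit K (\<lambda>n. f (r n)) g' sequentially" if "compact K" "K \<subseteq> disc" for K
      using g(3)[OF that]
      by (rule uniform_limit_cong'[THEN iffD1, rotated -1]) (use that in \<open>auto simp: g'_def\<close>)
  qed (fact g)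
qed

text \<open>Fatou's lemma for each \<mu> separately. Even for \<open>f n\<close> in \<open>X\<close>
  the limit is only placed in \<open>Y\<close>, since tails need not stay uniformly small: this is
  how the bidual of \<open>X\<close> comes to be \<open>Y\<close>.\<close>

lemma norm_limit_le:
  assumes f: "\<And>n::nat. f n \<in> Y" "\<And>n. N (f n) \<le> b" and g: "g \<in> hol_disc"
    and lim: "\<And>z. z \<in> disc \<Longrightarrow> (\<lambda>n. f n z) \<longlonglongrightarrow> g z"
  shows "g \<in> Y" "N g \<le> b"
proof -
  have b: "0 \<le> b" using f(2)[of 0] N_nonneg[of "f 0"] by simp
  have "power_integral p \<mu> UNIV g \<le> ennreal (b powr p)" if \<mu>: "\<mu> \<in> \<M>" for \<mu>
  proof -
    note sets_\<M>[OF \<mu>, measurable_cong] and hol_disc_borel[OF Y_hol[OF f(1)], measurable]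
    have "(\<lambda>n. f n z) \<longlonglongrightarrow> g z" for z
      using lim[of z] hol_disc_outside[OF g, of z] hol_disc_outside[OF Y_hol[OF f(1)], of z]
      by (cases "z \<in> disc") auto
    then have "(\<lambda>n. ennreal (cmod (f n z) powr p)) \<longlonglongrightarrow> ennreal (cmod (g z) powr p)" for z
      using p by (intro tendsto_ennrealI tendsto_powr' tendsto_intros) auto
    then have L: "liminf (\<lambda>n. ennreal (cmod (f n z) powr p)) = ennreal (cmod (g z) powr p)" for z
      by (rule lim_imp_Liminf[OF sequentially_bot])
    have "power_integral p \<mu> UNIV g = (\<integral>\<^sup>+z. liminf (\<lambda>n. ennreal (cmod (f n z) powr p)) \<partial>\<mu>)"
      unfolding power_integral_def L by simp
    also have "\<dots> \<le> liminf (\<lambda>n. \<integral>\<^sup>+z. ennreal (cmod (f n z) powr p) \<partial>\<mu>)"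
      by (rule nn_integral_liminf) measurable
    also have "\<dots> \<le> liminf (\<lambda>n. ennreal (b powr p))"
    proof (intro Liminf_mono always_eventually allI)
      show "(\<integral>\<^sup>+z. ennreal (cmod (f n z) powr p) \<partial>\<mu>) \<le> ennreal (b powr p)" for n
        using N_le_iff[OF f(1) b, of n] f(2) \<mu> by (simp add: power_integral_def)
    qed
    finally show ?thesis by (simp add: Liminf_const)
  qed
  with Y_N_leI[OF g b] show "g \<in> Y" "N g \<le> b" by auto
qed

lemma evaluation_dual:
  assumes "V \<subseteq> Y" "normed_functions V N"
  shows "evaluation V z \<in> dual_space V N"
proof (cases "z \<in> disc")
  case True
  interpret V: normed_functions V N by fact
  obtain C where C: "0 \<le> C" "\<And>f w. f \<in> Y \<Longrightarrow> w \<in> cball 0 (cmod z) \<Longrightarrow> cmod (f w) \<le> C * N f"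
    using pointwise_bound[of "cmod z"] True by (auto simp: disc_def)
  show ?thesis
    by (rule V.dualI[where C = C])
       (use C(2)[of _ z] assms(1) in \<open>auto simp: evaluation_def V.add V.scale\<close>)
next
  case False
  have "evaluation V z = (\<lambda>_. 0)"
  proof
    show "evaluation V z f = 0" for f
      using assms(1) hol_disc_outside[OF Y_hol False, of f] by (auto simp: evaluation_def)
  qed
  then show ?thesis
    using normed_functions.zero[OF normed_functions.normed_functions_dual[OF assms(2)]] by simp
qed

lemma evaluation_X: "evaluation X z \<in> dual_space X N"
  by (rule evaluation_dual) (use X_subset_Y X.normed_functions_axioms in auto)

end

subsection \<open>The bidual\<close>

context radial_space
begin

definition represent :: "(((complex \<Rightarrow> complex) \<Rightarrow> complex) \<Rightarrow> complex) \<Rightarrow> complex \<Rightarrow> complex" where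
  "represent \<Phi> z = \<Phi> (evaluation X z)"

interpretation dual_X: normed_functions "dual_space X N" "dual_norm X N"
  by (rule X.normed_functions_dual)

text \<open>Goldstine's sequence controls \<phi> and evaluations at countably many points, and
  Montel's theorem then yields some limit \<open>g\<close>. To reach an arbitrary \<open>z\<close>,
  it is added to fixed test points: the limits for different \<open>z\<close> agree at the test
  points, hence everywhere, and so equal \<open>represent \<Phi>\<close>.\<close>

lemma represent_approx:
  assumes \<Phi>: "\<Phi> \<in> bidual_space X N" and \<phi>: "\<phi> \<in> dual_space X N"
  obtains f where "\<And>n::nat. f n \<in> X" "\<And>n. N (f n) \<le> bidual_norm X N \<Phi>"
    "\<And>K. compact K \<Longrightarrow> K \<subseteq> disc \<Longrightarrow> uniform_limit K f (represent \<Phi>) sequentially"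
    "(\<lambda>n. \<phi> (f n)) \<longlonglongrightarrow> \<Phi> \<phi>" "represent \<Phi> \<in> hol_disc"
proof -
  have ex: "\<exists>f g. (\<forall>n::nat. f n \<in> X \<and> N (f n) \<le> bidual_norm X N \<Phi>) \<and> g \<in> hol_disc
      \<and> (\<forall>K. compact K \<longrightarrow> K \<subseteq> disc \<longrightarrow> uniform_limit K f g sequentially)
      \<and> (\<lambda>n. \<phi> (f n)) \<longlonglongrightarrow> \<Phi> \<phi> \<and> g z = represent \<Phi> z
      \<and> (\<forall>j::nat. g (of_real (inverse (real (j + 2)))) = represent \<Phi> (of_real (inverse (real (j + 2)))))"
    if z: "z \<in> disc" for z
  proof -
    \<comment> \<open>Slot 0 is kept for \<phi>. Slot 1 is free for \<open>z\<close>, because the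
      point 1 lies outside the open disc. The slots from 2 on hold the test points.\<close>
    define w where "w j = (if j = 1 then z else of_real (inverse (real j)))" for j :: nat
    have w: "w j \<in> disc" if "0 < j" for j
    proof (cases "j = 1")
      case False
      then have "inverse (real j) < 1" using that by (simp add: field_simps)
      moreover have "cmod (w j) = inverse (real j)" using False unfolding w_def by (simp add: norm_inverse)
      ultimately show ?thesis by (simp add: disc_def)
    qed (simp add: w_def z)
    define \<psi> where "\<psi> j = (if j = 0 then \<phi> else evaluation X (w j))" for j
    have \<psi>: "\<psi> j \<in> dual_space X N" for j by (simp add: \<psi>_def \<phi> evaluation_X)
    obtain x where x: "\<And>n::nat. x n \<in> X" "\<And>n. N (x n) \<le> bidual_norm X N \<Phi>"
      "\<And>j. (\<lambda>n. \<psi> j (x n)) \<longlonglongrightarrow> \<Phi> (\<psi> j)"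
      by (rule X.goldstine_sequence[OF \<Phi>, of \<psi>, OF \<psi>]) blast
    obtain g r where g: "g \<in> hol_disc" "strict_mono r"
      "\<And>K. compact K \<Longrightarrow> K \<subseteq> disc \<Longrightarrow> uniform_limit K (\<lambda>n. x (r n)) g sequentially"
      by (rule montel_disc[of x, OF X_subset_Y[OF x(1)] x(2)]) blast
    have lim: "(\<lambda>n. \<psi> j (x (r n))) \<longlonglongrightarrow> \<Phi> (\<psi> j)" for j
      using LIMSEQ_subseq_LIMSEQ[OF x(3) g(2)] by (simp add: o_def)
    have gw: "g (w j) = represent \<Phi> (w j)" if "0 < j" for j
    proof (rule LIMSEQ_unique)
      show "(\<lambda>n. x (r n) (w j)) \<longlonglongrightarrow> g (w j)"
        by (rule uniform_limit_imp_pointwise_disc[OF g(3) w[OF that]])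
      show "(\<lambda>n. x (r n) (w j)) \<longlonglongrightarrow> represent \<Phi> (w j)"
        using lim[of j] that by (simp add: \<psi>_def represent_def evaluation_def x)
    qed
    have "(\<lambda>n. \<phi> (x (r n))) \<longlonglongrightarrow> \<Phi> \<phi>" using lim[of 0] by (simp add: \<psi>_def)
    moreover have "g z = represent \<Phi> z" using gw[of 1] by (simp add: w_def)
    moreover have "g (of_real (inverse (real (j + 2)))) = represent \<Phi> (of_real (inverse (real (j + 2))))" for j
      using gw[of "j + 2"] unfolding w_def by simp
    ultimately show ?thesis
      by (intro exI[of _ "\<lambda>n. x (r n)"] exI[of _ g] conjI allI impI x g)
  qed
  obtain f g where fg: "\<And>n::nat. f n \<in> X" "\<And>n. N (f n) \<le> bidual_norm X N \<Phi>" "g \<in> hol_disc"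
      "\<And>K. compact K \<Longrightarrow> K \<subseteq> disc \<Longrightarrow> uniform_limit K f g sequentially"
      "(\<lambda>n. \<phi> (f n)) \<longlonglongrightarrow> \<Phi> \<phi>"
      "\<And>j::nat. g (of_real (inverse (real (j + 2)))) = represent \<Phi> (of_real (inverse (real (j + 2))))"
    \<comment> \<open>Any \<open>z\<close> would do: this one sequence is kept, and the other
      choices of \<open>z\<close> only identify its limit.\<close>
    using ex[of 0] by (auto simp: disc_def)
  have "g = represent \<Phi>"
  proof
    fix z
    show "g z = represent \<Phi> z"
    proof (cases "z \<in> disc")
      case True
      obtain h where "h \<in> hol_disc" "h z = represent \<Phi> z"
        "\<And>j::nat. h (of_real (inverse (real (j + 2)))) = represent \<Phi> (of_real (inverse (real (j + 2))))"
        using ex[OF True] by blast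
      then show ?thesis using hol_disc_eqI[OF fg(3), of h] fg(6) by simp
    next
      case False
      then have "evaluation X z = (\<lambda>_. 0)"
        using hol_disc_outside[OF X_hol] by (auto simp: evaluation_def)
      then show ?thesis
        using dual_X.dual_zero[OF \<Phi>] hol_disc_outside[OF fg(3) False] by (simp add: represent_def)
    qed
  qed
  with fg that show thesis by blast
qed

lemma represent_mem: "\<Phi> \<in> bidual_space X N \<Longrightarrow> represent \<Phi> \<in> Y"
  and represent_norm_le: "\<Phi> \<in> bidual_space X N \<Longrightarrow> N (represent \<Phi>) \<le> bidual_norm X N \<Phi>"
proof -
  assume \<Phi>: "\<Phi> \<in> bidual_space X N"
  obtain f where f: "\<And>n::nat. f n \<in> X" "\<And>n. N (f n) \<le> bidual_norm X N \<Phi>"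
    "\<And>K. compact K \<Longrightarrow> K \<subseteq> disc \<Longrightarrow> uniform_limit K f (represent \<Phi>) sequentially"
    "represent \<Phi> \<in> hol_disc"
    \<comment> \<open>The zero functional stands in for \<phi>: only the locally uniform
      approximation is wanted.\<close>
    using represent_approx[OF \<Phi> dual_X.zero] by metis
  show "represent \<Phi> \<in> Y" "N (represent \<Phi>) \<le> bidual_norm X N \<Phi>"
    using norm_limit_le[OF X_subset_Y[OF f(1)] f(2) f(4) uniform_limit_imp_pointwise_disc[OF f(3)]] by auto
qed

text \<open>The sequence of \<open>represent_approx\<close> may be replaced by any bounded sequence
  with the same limit, as their difference falls under \<open>dual_tendsto_zero\<close>. Thus \<Phi>
  can be read off from the function it represents.\<close>

lemma bidual_eq_limit:
  assumes \<Phi>: "\<Phi> \<in> bidual_space X N" and \<phi>: "\<phi> \<in> dual_space X N"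
    and h: "\<And>n::nat. h n \<in> X" "\<And>n. N (h n) \<le> b"
    and lim: "\<And>K. compact K \<Longrightarrow> K \<subseteq> disc \<Longrightarrow> uniform_limit K h (represent \<Phi>) sequentially"
  shows "(\<lambda>n. \<phi> (h n)) \<longlonglongrightarrow> \<Phi> \<phi>"
proof -
  obtain f where f: "\<And>n::nat. f n \<in> X" "\<And>n. N (f n) \<le> bidual_norm X N \<Phi>"
    "\<And>K. compact K \<Longrightarrow> K \<subseteq> disc \<Longrightarrow> uniform_limit K f (represent \<Phi>) sequentially"
    "(\<lambda>n. \<phi> (f n)) \<longlonglongrightarrow> \<Phi> \<phi>"
    using represent_approx[OF \<Phi> \<phi>] by metis
  have "(\<lambda>n. \<phi> (\<lambda>z. h n z - f n z)) \<longlonglongrightarrow> 0"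
  proof (rule dual_tendsto_zero[OF \<phi>])
    show "(\<lambda>z. h n z - f n z) \<in> X" for n by (intro X.diff h f)
    show "N (\<lambda>z. h n z - f n z) \<le> b + bidual_norm X N \<Phi>" for n
      using X.norm_diff_le[OF h(1) f(1), of n n] h(2)[of n] f(2)[of n] by simp
    show "uniform_limit K (\<lambda>n z. h n z - f n z) (\<lambda>_. 0) sequentially" if "compact K" "K \<subseteq> disc" for K
      using uniform_limit_minus[OF lim[OF that] f(3)[OF that]] by simp
  qed
  then have "(\<lambda>n. \<phi> (h n) - \<phi> (f n)) \<longlonglongrightarrow> 0"
    by (simp add: X.dual_diff[OF \<phi> h(1) f(1)])
  from tendsto_add[OF this f(4)] show ?thesis by simp
qed

text \<open>\<open>dual_tendsto_zero\<close> asks for one bound on all \<open>h n\<close>, whereas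
  the exact norm needs the factors \<open>c n\<close>; both are recorded.\<close>

lemma approx_bounded:
  assumes "g \<in> Y"
  obtains h c b where "\<And>n::nat. h n \<in> X" "\<And>n. N (h n) \<le> c n * N g" "c \<longlonglongrightarrow> 1" "\<And>n. N (h n) \<le> b"
    "\<And>K. compact K \<Longrightarrow> K \<subseteq> disc \<Longrightarrow> uniform_limit K h g sequentially"
proof -
  obtain h c where h: "\<And>n::nat. h n \<in> X" "\<And>n. N (h n) \<le> c n * N g" "c \<longlonglongrightarrow> 1"
    "\<And>K. compact K \<Longrightarrow> K \<subseteq> disc \<Longrightarrow> uniform_limit K h g sequentially"
    using approx[OF assms] by blast
  obtain B where B: "\<And>n. norm (c n) \<le> B"
    using convergent_imp_Bseq[OF convergentI[OF h(3)]] unfolding Bseq_def by blast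
  have "N (h n) \<le> B * N g" for n
    using h(2)[of n] mult_right_mono[OF order_trans[OF abs_ge_self B[of n, unfolded real_norm_def]] N_nonneg[of g]] by linarith
  with h that show thesis by blast
qed

text \<open>The missing inequality is the limit of \<open>dual_bound\<close> along
  \<open>h n\<close>. Since \<open>c n\<close> tends to 1, it holds with constant 1; a mere bound on
  \<open>h n\<close> would only give equivalent norms.\<close>

lemma represent_norm:
  assumes \<Phi>: "\<Phi> \<in> bidual_space X N"
  shows "N (represent \<Phi>) = bidual_norm X N \<Phi>"
proof (rule antisym[OF represent_norm_le[OF \<Phi>]])
  obtain h c b where h: "\<And>n::nat. h n \<in> X" "\<And>n. N (h n) \<le> c n * N (represent \<Phi>)" "c \<longlonglongrightarrow> 1" "\<And>n. N (h n) \<le> b"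
    "\<And>K. compact K \<Longrightarrow> K \<subseteq> disc \<Longrightarrow> uniform_limit K h (represent \<Phi>) sequentially"
    using approx_bounded[OF represent_mem[OF \<Phi>]] by metis
  show "bidual_norm X N \<Phi> \<le> N (represent \<Phi>)"
  proof (rule dual_X.dual_norm_le_bound[OF N_nonneg])
    fix \<phi> assume \<phi>: "\<phi> \<in> dual_space X N"
    have "(\<lambda>n. cmod (\<phi> (h n))) \<longlonglongrightarrow> cmod (\<Phi> \<phi>)"
      by (rule tendsto_norm[OF bidual_eq_limit[OF \<Phi> \<phi> h(1,4,5)]])
    moreover have "(\<lambda>n. dual_norm X N \<phi> * (c n * N (represent \<Phi>))) \<longlonglongrightarrow> dual_norm X N \<phi> * (1 * N (represent \<Phi>))"
      by (intro tendsto_intros h)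
    moreover have "cmod (\<phi> (h n)) \<le> dual_norm X N \<phi> * (c n * N (represent \<Phi>))" for n
      using X.dual_bound[OF \<phi> h(1)[of n]] mult_left_mono[OF h(2)[of n] X.dual_norm_nonneg[OF \<phi>]] by linarith
    ultimately show "cmod (\<Phi> \<phi>) \<le> N (represent \<Phi>) * dual_norm X N \<phi>"
      using LIMSEQ_le by (fastforce simp: mult.commute)
  qed
qed

text \<open>\<Phi> is the limit of \<open>\<phi> (h n)\<close>. If these scalars were not Cauchy,
  some differences \<open>h (m k) - h (n k)\<close> would be bounded and tend to 0 locally uniformly
  while their values under \<phi> stay away from 0.\<close>

lemma represent_surj:
  assumes g: "g \<in> Y"
  shows "\<exists>\<Phi>\<in>bidual_space X N. represent \<Phi> = g"
proof -
  obtain h c b where h: "\<And>n::nat. h n \<in> X" "\<And>n. N (h n) \<le> c n * N g" "c \<longlonglongrightarrow> 1" "\<And>n. N (h n) \<le> b"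
    "\<And>K. compact K \<Longrightarrow> K \<subseteq> disc \<Longrightarrow> uniform_limit K h g sequentially"
    using approx_bounded[OF g] by metis
  have conv: "convergent (\<lambda>n. \<phi> (h n))" if \<phi>: "\<phi> \<in> dual_space X N" for \<phi>
  proof (rule Cauchy_convergent, rule ccontr)
    assume "\<not> Cauchy (\<lambda>n. \<phi> (h n))"
    then obtain e where e: "0 < e" "\<And>M. \<exists>m\<ge>M. \<exists>n\<ge>M. e \<le> dist (\<phi> (h m)) (\<phi> (h n))"
      unfolding Cauchy_def by (auto simp: not_less)
    then obtain m n where mn: "\<And>k. k \<le> m k" "\<And>k. k \<le> n k" "\<And>k. e \<le> dist (\<phi> (h (m k))) (\<phi> (h (n k)))"
      by metis
    have top: "filterlim m sequentially sequentially" "filterlim n sequentially sequentially"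
      by (rule filterlim_at_top_mono[OF filterlim_ident]; use mn in simp)+
    have "(\<lambda>k. \<phi> (\<lambda>z. h (m k) z - h (n k) z)) \<longlonglongrightarrow> 0"
    proof (rule dual_tendsto_zero[OF \<phi>])
      show "(\<lambda>z. h (m k) z - h (n k) z) \<in> X" for k by (intro X.diff h)
      show "N (\<lambda>z. h (m k) z - h (n k) z) \<le> b + b" for k
        using X.norm_diff_le[OF h(1) h(1), of "m k" "n k"] h(4)[of "m k"] h(4)[of "n k"] by simp
      show "uniform_limit K (\<lambda>k z. h (m k) z - h (n k) z) (\<lambda>_. 0) sequentially" if "compact K" "K \<subseteq> disc" for K
        using uniform_limit_minus[OF filterlim_compose[OF h(5)[OF that] top(1)]
            filterlim_compose[OF h(5)[OF that] top(2)]] by simp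
    qed
    then have "(\<lambda>k. dist (\<phi> (h (m k))) (\<phi> (h (n k)))) \<longlonglongrightarrow> 0"
      by (simp add: X.dual_diff[OF \<phi> h(1) h(1)] dist_norm tendsto_norm_zero_iff)
    then have "e \<le> 0" by (rule LIMSEQ_le_const) (use mn in auto)
    with e show False by simp
  qed
  define \<Phi> where "\<Phi> \<phi> = (if \<phi> \<in> dual_space X N then lim (\<lambda>n. \<phi> (h n)) else 0)" for \<phi>
  have \<Phi>lim: "(\<lambda>n. \<phi> (h n)) \<longlonglongrightarrow> \<Phi> \<phi>" if "\<phi> \<in> dual_space X N" for \<phi>
    using conv[OF that] that by (simp add: \<Phi>_def convergent_LIMSEQ_iff)
  have "\<Phi> \<in> bidual_space X N"
  proof (rule dual_X.dualI)
    show "\<Phi> \<phi> = 0" if "\<phi> \<notin> dual_space X N" for \<phi> using that by (simp add: \<Phi>_def)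
    show "\<Phi> (\<lambda>x. \<phi> x + \<psi> x) = \<Phi> \<phi> + \<Phi> \<psi>" if "\<phi> \<in> dual_space X N" "\<psi> \<in> dual_space X N" for \<phi> \<psi>
      by (rule LIMSEQ_unique[OF \<Phi>lim[OF dual_X.add[OF that]] tendsto_add[OF \<Phi>lim[OF that(1)] \<Phi>lim[OF that(2)]]])
    show "\<Phi> (\<lambda>x. a * \<phi> x) = a * \<Phi> \<phi>" if "\<phi> \<in> dual_space X N" for a \<phi>
      by (rule LIMSEQ_unique[OF \<Phi>lim[OF dual_X.scale[OF that]] tendsto_mult_left[OF \<Phi>lim[OF that]]])
    show "cmod (\<Phi> \<phi>) \<le> b * dual_norm X N \<phi>" if \<phi>: "\<phi> \<in> dual_space X N" for \<phi>
    proof (rule LIMSEQ_le_const2[OF tendsto_norm[OF \<Phi>lim[OF \<phi>]]], intro exI allI impI)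
      show "cmod (\<phi> (h n)) \<le> b * dual_norm X N \<phi>" for n
        using X.dual_bound[OF \<phi> h(1)[of n]] mult_left_mono[OF h(4)[of n] X.dual_norm_nonneg[OF \<phi>]]
        by (simp add: mult.commute)
    qed
  qed
  moreover have "represent \<Phi> = g"
  proof
    fix z
    have "(\<lambda>n. h n z) \<longlonglongrightarrow> represent \<Phi> z"
      using \<Phi>lim[OF evaluation_X[of z]] h(1) by (simp add: represent_def evaluation_def)
    moreover have "(\<lambda>n. h n z) \<longlonglongrightarrow> g z"
    proof (cases "z \<in> disc")
      case True
      show ?thesis by (rule uniform_limit_imp_pointwise_disc[OF h(5) True])
    qed (simp add: hol_disc_outside[OF X_hol[OF h(1)]] hol_disc_outside[OF Y_hol[OF g]])
    ultimately show "represent \<Phi> z = g z" by (rule LIMSEQ_unique)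
  qed
  ultimately show ?thesis by blast
qed

text \<open>Both functionals are limits along one approximating sequence, which depends on the
  represented function only.\<close>

lemma represent_inj: "inj_on represent (bidual_space X N)"
proof (rule inj_onI)
  fix \<Phi> \<Psi> assume \<Phi>: "\<Phi> \<in> bidual_space X N" and \<Psi>: "\<Psi> \<in> bidual_space X N" and eq: "represent \<Phi> = represent \<Psi>"
  obtain h c b where h: "\<And>n::nat. h n \<in> X" "\<And>n. N (h n) \<le> c n * N (represent \<Phi>)" "c \<longlonglongrightarrow> 1" "\<And>n. N (h n) \<le> b"
    "\<And>K. compact K \<Longrightarrow> K \<subseteq> disc \<Longrightarrow> uniform_limit K h (represent \<Phi>) sequentially"
    using approx_bounded[OF represent_mem[OF \<Phi>]] by metis
  show "\<Phi> = \<Psi>"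
  proof
    fix \<phi>
    show "\<Phi> \<phi> = \<Psi> \<phi>"
    proof (cases "\<phi> \<in> dual_space X N")
      case True
      show ?thesis
        by (rule LIMSEQ_unique[OF bidual_eq_limit[OF \<Phi> True h(1,4,5)]
              bidual_eq_limit[OF \<Psi> True h(1,4) h(5)[unfolded eq]]])
    qed (simp add: dual_X.dual_outside[OF \<Phi>] dual_X.dual_outside[OF \<Psi>])
  qed
qed

text \<open>Evaluations are among the functionals, so the hypothesis contains pointwise convergence.
  Along any bad subsequence Montel's theorem makes it locally uniform, with limit 0.\<close>

lemma represent_uniform_limit_zero:
  assumes \<Phi>: "\<And>n::nat. \<Phi> n \<in> bidual_space X N" "\<And>n. bidual_norm X N (\<Phi> n) \<le> b"
    and lim: "\<And>\<phi>. \<phi> \<in> dual_space X N \<Longrightarrow> (\<lambda>n. \<Phi> n \<phi>) \<longlonglongrightarrow> 0"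
    and K: "compact K" "K \<subseteq> disc"
  shows "uniform_limit K (\<lambda>n. represent (\<Phi> n)) (\<lambda>_. 0) sequentially"
proof (rule ccontr)
  assume "\<not> uniform_limit K (\<lambda>n. represent (\<Phi> n)) (\<lambda>_. 0) sequentially"
  then obtain e where e: "0 < e" "\<And>n0. \<exists>n\<ge>n0. \<exists>z\<in>K. e \<le> cmod (represent (\<Phi> n) z)"
    unfolding uniform_limit_iff eventually_sequentially by (auto simp: not_less)
  then obtain m where m: "\<And>k. k \<le> m k" "\<And>k. \<exists>z\<in>K. e \<le> cmod (represent (\<Phi> (m k)) z)"
    by metis
  have top: "filterlim m sequentially sequentially"
    by (rule filterlim_at_top_mono[OF filterlim_ident]) (use m in simp)
  obtain g r where g: "strict_mono r"
    "\<And>K. compact K \<Longrightarrow> K \<subseteq> disc \<Longrightarrow> uniform_limit K (\<lambda>n. represent (\<Phi> (m (r n)))) g sequentially"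
    using montel_disc[of "\<lambda>n. represent (\<Phi> (m n))", OF represent_mem[OF \<Phi>(1)] order_trans[OF represent_norm_le[OF \<Phi>(1)] \<Phi>(2)]]
    by metis
  have "g z = 0" if "z \<in> disc" for z
  proof (rule LIMSEQ_unique[OF uniform_limit_imp_pointwise_disc[OF g(2) that]])
    have "(\<lambda>n. represent (\<Phi> n) z) \<longlonglongrightarrow> 0"
      unfolding represent_def by (rule lim[OF evaluation_X])
    then show "(\<lambda>n. represent (\<Phi> (m (r n))) z) \<longlonglongrightarrow> 0"
      by (rule filterlim_compose[OF _ filterlim_compose[OF top filterlim_subseq[OF g(1)]]])
  qed
  then have "\<forall>\<^sub>F n in sequentially. \<forall>z\<in>K. cmod (represent (\<Phi> (m (r n))) z) < e"
    using uniform_limitD[OF g(2)[OF K] e(1)] K by (auto simp: subset_iff elim!: eventually_mono)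
  then obtain n where "\<forall>z\<in>K. cmod (represent (\<Phi> (m (r n))) z) < e"
    unfolding eventually_sequentially by blast
  with m(2)[of "r n"] show False by force
qed

text \<open>Evaluations recover \<open>f\<close> from its embedding, so \<open>represent\<close> is
  a left inverse. Being injective, it is a right inverse as well once
  \<open>represent \<Phi>\<close> lies in \<open>X\<close>, and this is where \<open>X = Y\<close>
  enters.\<close>

lemma canonical_embedding_represent:
  assumes "X = Y"
  shows "bij_betw (canonical_embedding X N) X (bidual_space X N)"
    and "\<Phi> \<in> bidual_space X N \<Longrightarrow> canonical_embedding X N (represent \<Phi>) = \<Phi>"
proof -
  have mem: "canonical_embedding X N f \<in> bidual_space X N" if "f \<in> X" for f
  proof (rule dual_X.dualI)
    show "cmod (canonical_embedding X N f \<phi>) \<le> N f * dual_norm X N \<phi>" if "\<phi> \<in> dual_space X N" for \<phi>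
      using X.dual_bound[OF that \<open>f \<in> X\<close>] that by (simp add: canonical_embedding_def mult.commute)
  qed (simp_all add: canonical_embedding_def dual_X.add dual_X.scale)
  have rep: "represent (canonical_embedding X N f) = f" if "f \<in> X" for f
    using that evaluation_X by (auto simp: represent_def canonical_embedding_def evaluation_def)
  show can: "canonical_embedding X N (represent \<Phi>) = \<Phi>" if "\<Phi> \<in> bidual_space X N" for \<Phi>
  proof (rule inj_onD[OF represent_inj _ mem that])
    show "represent \<Phi> \<in> X" using represent_mem[OF that] assms by simp
    then show "represent (canonical_embedding X N (represent \<Phi>)) = represent \<Phi>" by (rule rep)
  qed
  show "bij_betw (canonical_embedding X N) X (bidual_space X N)"
    by (rule bij_betw_byWitness[where f' = represent]) (use rep can mem represent_mem assms in auto)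
qed

end

subsection \<open>The radial and the averaged measure\<close>

text \<open>Removes the \<open>p\<close>-th root from all the norms, infinite values
  included.\<close>

lemma ennreal_powr_le_iff:
  assumes "0 < p" "0 \<le> a"
  shows "ennreal_powr x (1 / p) \<le> ennreal a \<longleftrightarrow> x \<le> ennreal (a powr p)"
proof (cases x)
  case (real y)
  have "y powr (1 / p) \<le> a \<longleftrightarrow> y \<le> a powr p"
  proof
    assume "y powr (1 / p) \<le> a"
    then have "(y powr (1 / p)) powr p \<le> a powr p" using assms by (intro powr_mono2) auto
    then show "y \<le> a powr p" using assms real by (simp add: powr_powr)
  next
    assume "y \<le> a powr p"
    then have "y powr (1 / p) \<le> (a powr p) powr (1 / p)" using assms real by (intro powr_mono2) auto
    then show "y powr (1 / p) \<le> a" using assms by (simp add: powr_powr)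
  qed
  then show ?thesis using real assms by (simp add: ennreal_powr_def)
next
  case top
  then show ?thesis by (simp add: ennreal_powr_def top_unique)
qed

lemma ennreal_powr_measurable [measurable]: "(\<lambda>x. ennreal_powr x a) \<in> borel_measurable borel"
  unfolding ennreal_powr_def by measurable

lemma enn2real_le_iff:
  assumes "x < \<infinity>" "0 \<le> a"
  shows "enn2real x \<le> a \<longleftrightarrow> x \<le> ennreal a"
  using assms by (cases x) auto

definition radial_measure :: "real \<Rightarrow> complex measure" where
  "radial_measure t = distr (uniform_measure lborel {0<..<1}) borel (\<lambda>r. complex_of_real r * cis t)"

text \<open>This is \<open>dr dt / (2 pi)\<close>, of density \<open>1 / (2 pi |z|)\<close> with
  respect to area on the disc, not normalised area measure.\<close>

definition bergman_measure :: "complex measure" where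
  "bergman_measure = distr (uniform_measure lborel {0..2 * pi} \<Otimes>\<^sub>M uniform_measure lborel {0<..<1}) borel
     (\<lambda>(t, r). complex_of_real r * cis t)"

lemma cis_measurable [measurable]: "cis \<in> borel_measurable borel"
  by (intro borel_measurable_continuous_onI continuous_intros)

lemma sets_radial_measure: "sets (radial_measure t) = sets borel"
  by (simp add: radial_measure_def)

lemma sets_bergman_measure: "sets bergman_measure = sets borel"
  by (simp add: bergman_measure_def)

lemma prob_space_unit_interval: "prob_space (uniform_measure lborel {0<..<1::real})"
  by (rule prob_space_uniform_measure) auto

lemma prob_space_angles: "prob_space (uniform_measure lborel {0..2 * pi})"
  by (rule prob_space_uniform_measure) auto

lemma mass_radial_measure: "emeasure (radial_measure t) UNIV \<le> 1"
proof -
  interpret prob_space "radial_measure t"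
    unfolding radial_measure_def by (rule prob_space.prob_space_distr[OF prob_space_unit_interval]) measurable
  show ?thesis using emeasure_space_1 sets_eq_imp_space_eq[OF sets_radial_measure] by simp
qed

lemma mass_bergman_measure: "emeasure bergman_measure UNIV \<le> 1"
proof -
  interpret A: prob_space "uniform_measure lborel {0..2 * pi}" by (rule prob_space_angles)
  interpret R: prob_space "uniform_measure lborel {0<..<1::real}" by (rule prob_space_unit_interval)
  interpret P: pair_prob_space "uniform_measure lborel {0..2 * pi}" "uniform_measure lborel {0<..<1::real}" ..
  interpret prob_space bergman_measure
    unfolding bergman_measure_def by (rule P.prob_space_distr) measurable
  show ?thesis using emeasure_space_1 sets_eq_imp_space_eq[OF sets_bergman_measure] by simp
qed

lemma nn_integral_unit_interval:
  assumes [measurable]: "F \<in> borel_measurable borel"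
  shows "(\<integral>\<^sup>+r. F r \<partial>uniform_measure lborel {0<..<1::real}) = (\<integral>\<^sup>+r\<in>{0<..<1}. F r \<partial>lborel)"
proof -
  have "inverse (1 :: ennreal) = 1" using inverse_ennreal[of 1] by simp
  then show ?thesis by (simp add: nn_integral_uniform_measure divide_ennreal_def)
qed

lemma nn_integral_radial_measure:
  assumes [measurable]: "F \<in> borel_measurable borel"
  shows "(\<integral>\<^sup>+z. F z \<partial>radial_measure t) = (\<integral>\<^sup>+r\<in>{0<..<1}. F (complex_of_real r * cis t) \<partial>lborel)"
  unfolding radial_measure_def by (simp add: nn_integral_distr nn_integral_unit_interval)

lemma nn_integral_bergman_measure:
  assumes [measurable]: "F \<in> borel_measurable borel"
  shows "(\<integral>\<^sup>+z. F z \<partial>bergman_measure)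
    = ennreal (1 / (2 * pi)) * (\<integral>\<^sup>+t\<in>{0..2 * pi}. (\<integral>\<^sup>+z. F z \<partial>radial_measure t) \<partial>lborel)"
proof -
  interpret A: prob_space "uniform_measure lborel {0..2 * pi}" by (rule prob_space_angles)
  interpret R: prob_space "uniform_measure lborel {0<..<1::real}" by (rule prob_space_unit_interval)
  have "(\<integral>\<^sup>+z. F z \<partial>bergman_measure)
      = (\<integral>\<^sup>+t. \<integral>\<^sup>+r. F (complex_of_real r * cis t) \<partial>uniform_measure lborel {0<..<1} \<partial>uniform_measure lborel {0..2 * pi})"
    unfolding bergman_measure_def by (subst nn_integral_distr) (auto simp: R.nn_integral_fst[symmetric])
  also have "\<dots> = (\<integral>\<^sup>+t. (\<integral>\<^sup>+r\<in>{0<..<1}. F (complex_of_real r * cis t) \<partial>lborel) \<partial>uniform_measure lborel {0..2 * pi})"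
    by (simp add: nn_integral_unit_interval)
  also have "\<dots> = (\<integral>\<^sup>+t\<in>{0..2 * pi}. (\<integral>\<^sup>+r\<in>{0<..<1}. F (complex_of_real r * cis t) \<partial>lborel) \<partial>lborel) / ennreal (2 * pi)"
    by (subst nn_integral_uniform_measure) auto
  also have "\<dots> = ennreal (1 / (2 * pi)) * (\<integral>\<^sup>+t\<in>{0..2 * pi}. (\<integral>\<^sup>+z. F z \<partial>radial_measure t) \<partial>lborel)"
    by (simp add: nn_integral_radial_measure divide_ennreal_def inverse_ennreal inverse_eq_divide mult.commute)
  finally show ?thesis .
qed

text \<open>The part of a radius outside \<open>cball 0 s\<close> is \<open>{s<..<1}\<close> for
  nonnegative \<open>s\<close> only; for \<open>s < 0\<close> the radial integral would also run
  over negative radii.\<close>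

lemma power_integral_radial_measure:
  assumes "f \<in> hol_disc"
  shows "power_integral p (radial_measure t) UNIV f = radial_integral p 0 f t"
    and "0 \<le> s \<Longrightarrow> power_integral p (radial_measure t) (- cball 0 s) f = radial_integral p s f t"
proof -
  note hol_disc_borel[OF assms, measurable]
  show "power_integral p (radial_measure t) UNIV f = radial_integral p 0 f t"
    unfolding power_integral_def radial_integral_def by (simp add: nn_integral_radial_measure)
  show "power_integral p (radial_measure t) (- cball 0 s) f = radial_integral p s f t" if "0 \<le> s"
    unfolding power_integral_def radial_integral_def
    by (subst nn_integral_radial_measure)
       (use that in \<open>auto intro!: nn_integral_cong simp: indicator_def norm_mult\<close>)
qed

lemma radial_integral_antimono: "s \<le> s' \<Longrightarrow> radial_integral p s' f t \<le> radial_integral p s f t"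
  unfolding radial_integral_def by (intro nn_integral_mono mult_left_mono) (auto simp: indicator_def)

lemma radial_integral_measurable:
  assumes "f \<in> hol_disc"
  shows "radial_integral p s f \<in> borel_measurable borel"
proof -
  note hol_disc_borel[OF assms, measurable]
  show ?thesis unfolding radial_integral_def by measurable
qed

text \<open>The integrand is continuous in the angle for each \<open>r\<close>, but no dominating
  function is at hand near \<open>r = 1\<close>; hence Fatou's lemma and an inequality.\<close>

lemma radial_integral_le_liminf:
  assumes f: "f \<in> hol_disc" and p: "0 < p" and u: "u \<longlonglongrightarrow> t"
  shows "radial_integral p 0 f t \<le> liminf (\<lambda>n. radial_integral p 0 f (u n))"
proof -
  note hol_disc_borel[OF f, measurable]
  have "(\<lambda>n. ennreal (cmod (f (of_real r * cis (u n))) powr p) * indicator {0<..<1} r)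
      \<longlonglongrightarrow> ennreal (cmod (f (of_real r * cis t)) powr p) * indicator {0<..<1} r" for r
  proof (cases "r \<in> {0<..<1}")
    case True
    have "isCont f (of_real r * cis t)"
      using f True holomorphic_on_imp_continuous_on[of f disc]
      by (auto simp: hol_disc_def disc_def continuous_on_eq_continuous_at norm_mult)
    then have "(\<lambda>n. f (of_real r * cis (u n))) \<longlonglongrightarrow> f (of_real r * cis t)"
      by (rule isCont_tendsto_compose) (intro tendsto_intros isCont_tendsto_compose[OF _ u] continuous_intros)
    then show ?thesis
      using True p by (auto intro!: tendsto_intros tendsto_ennrealI tendsto_powr')
  qed simp
  then have "radial_integral p 0 f t
      = (\<integral>\<^sup>+r. liminf (\<lambda>n. ennreal (cmod (f (of_real r * cis (u n))) powr p) * indicator {0<..<1} r) \<partial>lborel)"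
    unfolding radial_integral_def
    by (intro nn_integral_cong lim_imp_Liminf[symmetric] sequentially_bot)
  also have "\<dots> \<le> liminf (\<lambda>n. radial_integral p 0 f (u n))"
    unfolding radial_integral_def by (rule nn_integral_liminf) measurable
  finally show ?thesis .
qed

lemma radial_integral_cis: "cis t = cis t' \<Longrightarrow> radial_integral p s f t = radial_integral p s f t'"
  by (simp add: radial_integral_def)

lemma cis_reduce:
  obtains t' where "t' \<in> {0..<2 * pi}" "cis t = cis t'"
proof (rule that[of "Arg2pi (cis t)"])
  show "Arg2pi (cis t) \<in> {0..<2 * pi}" using Arg2pi_ge_0 Arg2pi_lt_2pi by simp
  show "cis t = cis (Arg2pi (cis t))"
    using Arg2pi_eq[of "cis t"] by (simp add: cis_conv_exp)
qed

text \<open>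
  By Fatou's lemma the radial integral is lower semicontinuous in the angle, so that its essential
  supremum is a supremum over all angles.
\<close>
lemma rho_infty_le_iff:
  assumes f: "f \<in> hol_disc" and p: "0 < p" and a: "0 \<le> a"
  shows "rho_infty p f \<le> ennreal a \<longleftrightarrow> (\<forall>t. radial_integral p 0 f t \<le> ennreal (a powr p))"
proof
  note radial_integral_measurable[OF f, measurable]
  assume "\<forall>t. radial_integral p 0 f t \<le> ennreal (a powr p)"
  then show "rho_infty p f \<le> ennreal a"
    unfolding rho_infty_def
    by (intro esssup_I measurable_restrict_space1) (auto simp: ennreal_powr_le_iff[OF p a])
next
  assume le: "rho_infty p f \<le> ennreal a"
  let ?P = "\<lambda>t. radial_integral p 0 f t \<le> ennreal (a powr p)"
  have "AE t in restrict_space lborel {0..<2 * pi}. ?P t"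
    using esssup_AE[of "\<lambda>t. ennreal_powr (radial_integral p 0 f t) (1 / p)" "restrict_space lborel {0..<2 * pi}"]
  proof eventually_elim
    case (elim t)
    from order_trans[OF elim le[unfolded rho_infty_def]] show ?case
      by (simp add: ennreal_powr_le_iff[OF p a])
  qed
  then have ae: "AE t in lborel. t \<in> {0..<2 * pi} \<longrightarrow> ?P t"
    by (subst (asm) AE_restrict_space_iff) auto
  \<comment> \<open>The null set of exceptional angles contains no interval. Approaching
    \<open>t0\<close> from the right, with the interval cut off at \<open>2 * pi\<close>, stays in
    the range of the essential supremum even for \<open>t0 = 0\<close>.\<close>
  have dense: "\<exists>t. t0 < t \<and> t < t0 + d \<and> ?P t" if "0 \<le> t0" "t0 < 2 * pi" "0 < d" for t0 d
  proof (rule ccontr)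
    assume no: "\<not> ?thesis"
    define b where "b = min (t0 + d) (2 * pi)"
    have "AE t in lborel. t \<notin> {t0<..<b}"
      using ae by eventually_elim (use no that in \<open>auto simp: b_def\<close>)
    then have "emeasure lborel {t0<..<b} = 0"
      by (subst (asm) AE_iff_measurable[of "{t0<..<b}"]) auto
    moreover have "t0 < b" using that by (simp add: b_def)
    ultimately show False by simp
  qed
  have P: "?P t0" if t0: "t0 \<in> {0..<2 * pi}" for t0
  proof -
    have "\<exists>t. t0 < t \<and> t < t0 + inverse (real (Suc n)) \<and> ?P t" for n
      using dense[of t0 "inverse (real (Suc n))"] t0 by auto
    then obtain u where u: "\<And>n. t0 < u n" "\<And>n. u n < t0 + inverse (real (Suc n))" "\<And>n. ?P (u n)"
      by metis
    have "u \<longlonglongrightarrow> t0"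
    proof (rule tendsto_sandwich[OF _ _ tendsto_const])
      show "(\<lambda>n. t0 + inverse (real (Suc n))) \<longlonglongrightarrow> t0"
        using tendsto_add[OF tendsto_const LIMSEQ_inverse_real_of_nat, of t0] by simp
    qed (use u in \<open>auto intro!: always_eventually less_imp_le\<close>)
    then have "radial_integral p 0 f t0 \<le> liminf (\<lambda>n. radial_integral p 0 f (u n))"
      by (rule radial_integral_le_liminf[OF f p])
    also have "\<dots> \<le> liminf (\<lambda>n. ennreal (a powr p))"
      by (intro Liminf_mono always_eventually allI u)
    finally show ?thesis by (simp add: Liminf_const)
  qed
  show "\<forall>t. ?P t"
  proof
    fix t
    obtain t' where "t' \<in> {0..<2 * pi}" "cis t = cis t'" by (rule cis_reduce)
    then show "?P t" using P radial_integral_cis by metis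
  qed
qed

section \<open>Membership and norms as bounds on integrals\<close>

lemma rho_bergman_le_iff:
  assumes f: "f \<in> hol_disc" and p: "0 < p" and a: "0 \<le> a"
  shows "rho_bergman p f \<le> ennreal a \<longleftrightarrow> power_integral p bergman_measure UNIV f \<le> ennreal (a powr p)"
proof -
  note hol_disc_borel[OF f, measurable]
  have "power_integral p bergman_measure UNIV f
      = ennreal (1 / (2 * pi)) * (\<integral>\<^sup>+t\<in>{0..2 * pi}. radial_integral p 0 f t \<partial>lborel)"
    using power_integral_radial_measure(1)[OF f]
    by (simp add: power_integral_def nn_integral_bergman_measure)
  then show ?thesis by (simp add: rho_bergman_def ennreal_powr_le_iff[OF p a])
qed

lemma less_infinity_iff_le: "x < \<infinity> \<longleftrightarrow> (\<exists>a\<ge>0. x \<le> ennreal a)"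
  by (cases x) (auto simp: top_unique)

lemma RM_infty_iff:
  assumes "0 < p"
  shows "f \<in> RM_infty p \<longleftrightarrow> f \<in> hol_disc \<and> (\<exists>a\<ge>0. \<forall>t. radial_integral p 0 f t \<le> ennreal (a powr p))"
  using rho_infty_le_iff[OF _ assms] unfolding RM_infty_def less_infinity_iff_le by blast

lemma bergman_iff:
  assumes "0 < p"
  shows "f \<in> bergman p \<longleftrightarrow> f \<in> hol_disc \<and> (\<exists>a\<ge>0. power_integral p bergman_measure UNIV f \<le> ennreal (a powr p))"
  using rho_bergman_le_iff[OF _ assms] unfolding bergman_def less_infinity_iff_le by blast

lemma RM_infty_norm_le_iff:
  assumes "0 < p" "f \<in> RM_infty p" "0 \<le> a"
  shows "RM_infty_norm p f \<le> a \<longleftrightarrow> (\<forall>t. radial_integral p 0 f t \<le> ennreal (a powr p))"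
  using assms unfolding RM_infty_norm_def RM_infty_def by (simp add: enn2real_le_iff rho_infty_le_iff)

lemma bergman_norm_le_iff:
  assumes "0 < p" "f \<in> bergman p" "0 \<le> a"
  shows "bergman_norm p f \<le> a \<longleftrightarrow> power_integral p bergman_measure UNIV f \<le> ennreal (a powr p)"
  using assms unfolding bergman_norm_def bergman_def by (simp add: enn2real_le_iff rho_bergman_le_iff)

text \<open>The supremum is nonincreasing in \<open>s\<close>, so smallness at one radius for each
  \<open>e\<close> already means convergence to 0.\<close>

lemma RM_zero_iff:
  assumes p: "0 < p"
  shows "f \<in> RM_zero p \<longleftrightarrow> f \<in> hol_disc \<and>
    (\<forall>e>0. \<exists>s\<in>{0..<1}. \<forall>t. radial_integral p s f t \<le> ennreal (e powr p))"
proof -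
  let ?S = "\<lambda>s. SUP t. ennreal_powr (radial_integral p s f t) (1 / p)"
  have "(?S \<longlongrightarrow> 0) (at_left 1) \<longleftrightarrow> (\<forall>e>0. \<exists>s\<in>{0..<1}. \<forall>t. radial_integral p s f t \<le> ennreal (e powr p))"
  proof (intro iffI allI impI)
    fix e :: real assume lim: "(?S \<longlongrightarrow> 0) (at_left 1)" and e: "0 < e"
    have "\<forall>\<^sub>F s in at_left 1. ?S s < ennreal e"
      by (rule order_tendstoD(2)[OF lim]) (simp add: e)
    then obtain b where b: "b < 1" "\<And>s. b < s \<Longrightarrow> s < 1 \<Longrightarrow> ?S s < ennreal e"
      unfolding eventually_at_left_field by blast
    \<comment> \<open>The midpoint between \<open>max b 0\<close> and 1 lies beyond \<open>b\<close>
      and is a legitimate radius.\<close>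
    define s where "s = (max b 0 + 1) / 2"
    have s: "b < s" "0 \<le> s" "s < 1" using b(1) by (auto simp: s_def max_def)
    have "ennreal_powr (radial_integral p s f t) (1 / p) \<le> ennreal e" for t
      using b(2)[OF s(1,3)] SUP_upper[of t UNIV "\<lambda>t. ennreal_powr (radial_integral p s f t) (1 / p)"]
      by (auto intro: less_imp_le order_trans)
    then show "\<exists>s\<in>{0..<1}. \<forall>t. radial_integral p s f t \<le> ennreal (e powr p)"
      using s e by (intro bexI[of _ s]) (auto simp: ennreal_powr_le_iff[OF p])
  next
    assume small: "\<forall>e>0. \<exists>s\<in>{0..<1}. \<forall>t. radial_integral p s f t \<le> ennreal (e powr p)"
    show "(?S \<longlongrightarrow> 0) (at_left 1)"
    proof (rule order_tendstoI)
      fix a :: ennreal assume "0 < a"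
      then obtain c where c: "0 < c" "c < a" using dense by blast
      then obtain e where e: "c = ennreal e" "0 < e" by (cases c) auto
      obtain s where s: "s \<in> {0..<1}" "\<And>t. radial_integral p s f t \<le> ennreal (e powr p)"
        using small e(2) by blast
      have "?S y < a" if "s < y" for y
      proof -
        have "?S y \<le> ennreal e"
          using order_trans[OF radial_integral_antimono[of s y p f] s(2)] that e(2)
          by (intro SUP_least) (auto simp: ennreal_powr_le_iff[OF p])
        then show ?thesis using c e by (auto intro: le_less_trans)
      qed
      then show "\<forall>\<^sub>F y in at_left 1. ?S y < a"
        using s(1) by (auto simp: eventually_at_left_field)
    qed simp
  qed
  then show ?thesis unfolding RM_zero_def by blast
qed

subsection \<open>The Bergman space\<close>

text \<open>On the circle of radius \<open>r\<close> the Cauchy kernel is at most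
  \<open>1 / (r - s)\<close>, and the factor \<open>r\<close> of the arc length is at most 1. The
  integral is an extended one so that it can next be integrated over \<open>r\<close>.\<close>

lemma cauchy_circle_bound:
  assumes f: "f \<in> hol_disc" and s: "cmod z \<le> s" "s < r" "r < 1"
  shows "ennreal (cmod (f z)) \<le> ennreal (1 / (2 * pi * (r - s))) *
    (\<integral>\<^sup>+t\<in>{0..2 * pi}. ennreal (cmod (f (of_real r * cis t))) \<partial>lborel)"
proof -
  have s0: "0 \<le> s" using s(1) norm_ge_zero order_trans by blast
  have hol: "f holomorphic_on cball 0 r"
    using f cball_subset_disc[OF s(3)] by (auto simp: hol_disc_def intro: holomorphic_on_subset)
  define h where "h t = f (of_real r * cis t) / (of_real r * cis t - z) * of_real r * \<i> * cis t" for t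
  have "((\<lambda>u. f u / (u - z)) has_contour_integral (2 * of_real pi * \<i> * f z)) (circlepath 0 r)"
    using hol s by (intro Cauchy_integral_circlepath_simple) auto
  then have h: "(h has_integral (2 * of_real pi * \<i> * f z)) {0..2 * pi}"
    unfolding circlepath_def h_def by (subst (asm) has_contour_integral_part_circlepath_iff) simp_all
  have cont: "continuous_on {0..2 * pi} (\<lambda>t. cmod (f (of_real r * cis t)))"
    using s s0
    by (intro continuous_intros continuous_on_compose2[OF holomorphic_on_imp_continuous_on[OF hol]])
       (auto simp: norm_mult)
  define I where "I = integral {0..2 * pi} (\<lambda>t. cmod (f (of_real r * cis t)))"
  have I: "((\<lambda>t. cmod (f (of_real r * cis t))) has_integral I) {0..2 * pi}"
    unfolding I_def by (intro integrable_integral integrable_continuous_interval cont)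
  have I0: "0 \<le> I" by (rule has_integral_nonneg[OF I]) simp
  have "cmod (h t) \<le> 1 / (r - s) * cmod (f (of_real r * cis t))" for t
  proof -
    have "r - s \<le> cmod (of_real r * cis t - z)"
      using norm_triangle_ineq2[of "of_real r * cis t" z] s s0 by (simp add: norm_mult)
    then have "r / cmod (of_real r * cis t - z) \<le> 1 / (r - s)"
      using s s0 by (intro frac_le) auto
    then have "r / cmod (of_real r * cis t - z) * cmod (f (of_real r * cis t))
        \<le> 1 / (r - s) * cmod (f (of_real r * cis t))" by (rule mult_right_mono) simp
    then show ?thesis using s s0 by (simp add: h_def norm_mult norm_divide mult.commute)
  qed
  then have "cmod (integral {0..2 * pi} h) \<le> integral {0..2 * pi} (\<lambda>t. 1 / (r - s) * cmod (f (of_real r * cis t)))"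
    using has_integral_integrable[OF h] has_integral_integrable[OF has_integral_mult_right[OF I, of "1 / (r - s)"]]
    by (intro Henstock_Kurzweil_Integration.integral_norm_bound_integral) auto
  then have "2 * pi * cmod (f z) \<le> 1 / (r - s) * I"
    using integral_unique[OF h] integral_unique[OF has_integral_mult_right[OF I, of "1 / (r - s)"]] s
    by (simp add: norm_mult)
  then have "cmod (f z) \<le> 1 / (2 * pi * (r - s)) * I"
    using s by (simp add: field_simps)
  then have "ennreal (cmod (f z)) \<le> ennreal (1 / (2 * pi * (r - s))) * ennreal I"
    using s I0 by (simp add: ennreal_mult[symmetric] ennreal_leI)
  also have "ennreal I = (\<integral>\<^sup>+t\<in>{0..2 * pi}. ennreal (cmod (f (of_real r * cis t))) \<partial>lborel)"
    by (rule nn_integral_has_integral_lebesgue'[OF _ I, symmetric]) simp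
  finally show ?thesis .
qed

text \<open>Averaging the Cauchy estimate over the radii in \<open>((1 + s) / 2, 1)\<close>.\<close>
lemma bergman_local_bound:
  assumes p: "1 < p" and s: "0 \<le> s" "s < 1"
  shows "\<exists>C. \<forall>f\<in>bergman p. bergman_norm p f \<le> 1 \<longrightarrow> (\<forall>z\<in>cball 0 s. cmod (f z) \<le> C)"
proof (intro exI ballI impI)
  define u where "u = (1 + s) / 2"
  have u: "s < u" "u < 1" "0 < u" using s by (auto simp: u_def)
  \<comment> \<open>\<open>r - s\<close> exceeds \<open>u - s\<close> for all radii in the average,
    so \<open>c\<close> is independent of \<open>r\<close>.\<close>
  define c where "c = 1 / (2 * pi * (u - s))"
  have c: "0 \<le> c" using u by (simp add: c_def)
  fix f and z :: complex assume f: "f \<in> bergman p" and N: "bergman_norm p f \<le> 1" and z: "z \<in> cball 0 s"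
  have fh: "f \<in> hol_disc" using f by (simp add: bergman_def)
  note hol_disc_borel[OF fh, measurable]
  let ?F = "\<lambda>r t. ennreal (cmod (f (of_real r * cis t)))"
  have circle: "ennreal (cmod (f z)) \<le> ennreal c * (\<integral>\<^sup>+t\<in>{0..2 * pi}. ?F r t \<partial>lborel)" if r: "u < r" "r < 1" for r
  proof -
    have "ennreal (cmod (f z)) \<le> ennreal (1 / (2 * pi * (r - s))) * (\<integral>\<^sup>+t\<in>{0..2 * pi}. ?F r t \<partial>lborel)"
      using z r u by (intro cauchy_circle_bound[OF fh]) auto
    also have "\<dots> \<le> ennreal c * (\<integral>\<^sup>+t\<in>{0..2 * pi}. ?F r t \<partial>lborel)"
      using r u by (intro mult_right_mono ennreal_leI) (auto simp: c_def intro!: divide_left_mono mult_left_mono)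
    finally show ?thesis .
  qed
  \<comment> \<open>The constant integrated over \<open>{u<..<1}\<close> yields the factor
    \<open>1 - u\<close>; on the right the radii are enlarged to \<open>{0<..<1}\<close> to reach
    the Bergman integral.\<close>
  have "ennreal (cmod (f z) * (1 - u)) = (\<integral>\<^sup>+r\<in>{u<..<1}. ennreal (cmod (f z)) \<partial>lborel)"
    using u by (simp add: nn_integral_cmult_indicator ennreal_mult)
  also have "\<dots> \<le> (\<integral>\<^sup>+r. ennreal c * ((\<integral>\<^sup>+t\<in>{0..2 * pi}. ?F r t \<partial>lborel) * indicator {0<..<1} r) \<partial>lborel)"
    using circle u by (intro nn_integral_mono) (auto simp: indicator_def)
  also have "\<dots> = ennreal c * (\<integral>\<^sup>+r. (\<integral>\<^sup>+t. ?F r t * indicator {0..2 * pi} t * indicator {0<..<1} r \<partial>lborel) \<partial>lborel)"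
    by (simp add: nn_integral_cmult nn_integral_multc)
  also have "(\<integral>\<^sup>+r. (\<integral>\<^sup>+t. ?F r t * indicator {0..2 * pi} t * indicator {0<..<1} r \<partial>lborel) \<partial>lborel)
      = (\<integral>\<^sup>+t. (\<integral>\<^sup>+r. ?F r t * indicator {0..2 * pi} t * indicator {0<..<1} r \<partial>lborel) \<partial>lborel)"
    by (rule lborel_pair.Fubini') measurable
  also have "\<dots> = (\<integral>\<^sup>+t\<in>{0..2 * pi}. (\<integral>\<^sup>+w. ennreal (cmod (f w)) \<partial>radial_measure t) \<partial>lborel)"
  proof (rule nn_integral_cong)
    fix t
    show "(\<integral>\<^sup>+r. ?F r t * indicator {0..2 * pi} t * indicator {0<..<1} r \<partial>lborel)
        = (\<integral>\<^sup>+w. ennreal (cmod (f w)) \<partial>radial_measure t) * indicator {0..2 * pi} t"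
      by (subst nn_integral_radial_measure, simp, subst nn_integral_multc[symmetric], simp)
         (simp add: mult_ac)
  qed
  also have "\<dots> = ennreal (2 * pi) * (ennreal (1 / (2 * pi)) * \<dots>)"
    by (simp add: mult.assoc[symmetric] ennreal_mult[symmetric])
  also have "\<dots> = ennreal (2 * pi) * (\<integral>\<^sup>+w. ennreal (cmod (f w)) \<partial>bergman_measure)"
    by (subst nn_integral_bergman_measure) auto
  also have "(\<integral>\<^sup>+w. ennreal (cmod (f w)) \<partial>bergman_measure) \<le> ennreal 2"
  proof -
    \<comment> \<open>A crude substitute for Hoelder's inequality: mass at most 1 and norm at most 1
      give the constant 2.\<close>
    have "cmod (f w) \<le> 1 + cmod (f w) powr p" for w
    proof (cases "cmod (f w) \<le> 1")
      case False
      then show ?thesis using powr_mono[of 1 p "cmod (f w)"] p by simp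
    qed (simp add: add_increasing2)
    then have "(\<integral>\<^sup>+w. ennreal (cmod (f w)) \<partial>bergman_measure)
        \<le> (\<integral>\<^sup>+w. 1 + ennreal (cmod (f w) powr p) \<partial>bergman_measure)"
      by (intro nn_integral_mono) (metis ennreal_1 ennreal_leI ennreal_plus powr_ge_zero zero_le_one)
    also have "\<dots> = emeasure bergman_measure UNIV + power_integral p bergman_measure UNIV f"
      using sets_bergman_measure sets_eq_imp_space_eq[OF sets_bergman_measure]
      by (subst nn_integral_add) (auto simp: power_integral_def measurable_cong_sets[OF sets_bergman_measure refl])
    also have "\<dots> \<le> 1 + 1"
      using N bergman_norm_le_iff[OF _ f, of 1] p by (intro add_mono mass_bergman_measure) auto
    finally show ?thesis by (simp add: one_add_one)
  qed
  also have "ennreal c * (ennreal (2 * pi) * ennreal 2) = ennreal (c * (2 * pi * 2))"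
    using c by (simp only: ennreal_mult[symmetric] mult_nonneg_nonneg pi_ge_zero zero_le_numeral)
  finally have "ennreal (cmod (f z) * (1 - u)) \<le> ennreal (c * (2 * pi * 2))"
    by (simp add: mult_left_mono)
  then have "cmod (f z) * (1 - u) \<le> c * (2 * pi * 2)"
    using c by (subst (asm) ennreal_le_iff) auto
  then show "cmod (f z) \<le> c * (2 * pi * 2) / (1 - u)"
    using u by (simp add: field_simps)
qed

text \<open>Dominated convergence: the cut-off functions tend to 0 pointwise, also on the unit
  circle and beyond, where \<open>f\<close> is 0. This makes \<open>X = Y\<close> possible for a
  single measure.\<close>

lemma bergman_tails:
  assumes p: "0 < p" and f: "f \<in> bergman p" and e: "0 < e"
  shows "\<exists>s\<in>{0..<1}. power_integral p bergman_measure (- cball 0 s) f \<le> ennreal (e powr p)"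
proof -
  have fh: "f \<in> hol_disc" using f by (simp add: bergman_def)
  note hol_disc_borel[OF fh, measurable] sets_bergman_measure[measurable_cong]
  define s where "s n = 1 - inverse (real (Suc n))" for n
  have s: "0 \<le> s n" "s n < 1" for n by (auto simp: s_def field_simps)
  have slim: "s \<longlonglongrightarrow> 1"
    unfolding s_def using tendsto_diff[OF tendsto_const LIMSEQ_inverse_real_of_nat, of 1] by simp
  have lim: "(\<lambda>n. ennreal (cmod (f z) powr p) * indicator (- cball 0 (s n)) z) \<longlonglongrightarrow> 0" for z
  proof (cases "cmod z < 1")
    case True
    then have "\<forall>\<^sub>F n in sequentially. cmod z < s n" by (rule order_tendstoD(1)[OF slim])
    then have "\<forall>\<^sub>F n in sequentially. ennreal (cmod (f z) powr p) * indicator (- cball 0 (s n)) z = 0"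
      by eventually_elim simp
    then show ?thesis by (rule tendsto_eventually)
  next
    case False
    then show ?thesis using p hol_disc_outside[OF fh, of z] by (simp add: disc_def)
  qed
  have "(\<lambda>n. power_integral p bergman_measure (- cball 0 (s n)) f) \<longlonglongrightarrow> (\<integral>\<^sup>+z. 0 \<partial>bergman_measure)"
    unfolding power_integral_def
  proof (rule nn_integral_dominated_convergence[where w = "\<lambda>z. ennreal (cmod (f z) powr p)"])
    obtain a where "power_integral p bergman_measure UNIV f \<le> ennreal a"
      using f bergman_iff[OF p] by blast
    then show "(\<integral>\<^sup>+z. ennreal (cmod (f z) powr p) \<partial>bergman_measure) < \<infinity>"
      by (auto simp: power_integral_def intro: le_less_trans)
  qed (use lim in \<open>auto simp: indicator_def\<close>)
  then have "\<forall>\<^sub>F n in sequentially. power_integral p bergman_measure (- cball 0 (s n)) f < ennreal (e powr p)"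
    by (rule order_tendstoD) (use e in simp)
  then obtain n where "power_integral p bergman_measure (- cball 0 (s n)) f < ennreal (e powr p)"
    unfolding eventually_sequentially by blast
  then show ?thesis using s by (intro bexI[of _ "s n"]) auto
qed

lemma radial_space_bergman:
  assumes p: "1 < p"
  shows "radial_space p (bergman p) (bergman p) (bergman_norm p) {bergman_measure}"
proof
  have p0: "0 < p" using p by simp
  show "f \<in> bergman p \<longleftrightarrow> f \<in> hol_disc \<and> (\<exists>a\<ge>0. \<forall>\<mu>\<in>{bergman_measure}. power_integral p \<mu> UNIV f \<le> ennreal (a powr p))" for f
    using bergman_iff[OF p0] by simp
  show "0 \<le> bergman_norm p f" for f by (simp add: bergman_norm_def)
  show "bergman_norm p f \<le> a \<longleftrightarrow> (\<forall>\<mu>\<in>{bergman_measure}. power_integral p \<mu> UNIV f \<le> ennreal (a powr p))"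
    if "f \<in> bergman p" "0 \<le> a" for f a
    using bergman_norm_le_iff[OF p0 that] by simp
  \<comment> \<open>As \<open>X = Y\<close>, a constant sequence approximates.\<close>
  show "\<exists>h c. (\<forall>n::nat. h n \<in> bergman p \<and> bergman_norm p (h n) \<le> c n * bergman_norm p g) \<and> c \<longlonglongrightarrow> 1 \<and>
      (\<forall>K. compact K \<longrightarrow> K \<subseteq> disc \<longrightarrow> uniform_limit K h g sequentially)" if "g \<in> bergman p" for g
    using that by (intro exI[of _ "\<lambda>_. g"] exI[of _ "\<lambda>_. 1"]) (auto simp: uniform_limit_iff)
  show "f \<in> bergman p \<longleftrightarrow> f \<in> hol_disc \<and> (\<forall>e>0. \<exists>s\<in>{0..<1}. \<forall>\<mu>\<in>{bergman_measure}.
      power_integral p \<mu> (- cball 0 s) f \<le> ennreal (e powr p))" for f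
  proof
    assume "f \<in> bergman p"
    then show "f \<in> hol_disc \<and> (\<forall>e>0. \<exists>s\<in>{0..<1}. \<forall>\<mu>\<in>{bergman_measure}. power_integral p \<mu> (- cball 0 s) f \<le> ennreal (e powr p))"
      using bergman_tails[OF p0] by (auto simp: bergman_def)
  next
    assume "f \<in> hol_disc \<and> (\<forall>e>0. \<exists>s\<in>{0..<1}. \<forall>\<mu>\<in>{bergman_measure}. power_integral p \<mu> (- cball 0 s) f \<le> ennreal (e powr p))"
    then obtain s where f: "f \<in> hol_disc" and s: "0 \<le> s" "s < 1" "power_integral p bergman_measure (- cball 0 s) f \<le> ennreal (1 powr p)"
      by (metis atLeastLessThan_iff singletonI zero_less_one)
    obtain B where B: "0 \<le> B" "\<And>z. z \<in> cball 0 s \<Longrightarrow> cmod (f z) \<le> B"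
      by (rule hol_disc_bounded_cball[OF f s(2)]) blast
    have "power_integral p bergman_measure UNIV f
        = power_integral p bergman_measure (cball 0 s) f + power_integral p bergman_measure (- cball 0 s) f"
      by (intro power_integral_split sets_bergman_measure hol_disc_borel f) auto
    also have "\<dots> \<le> ennreal (B powr p) + ennreal (1 powr p)"
      using p B by (intro add_mono s power_integral_le_const sets_bergman_measure mass_bergman_measure) auto
    also have "\<dots> = ennreal (((B powr p + 1) powr (1 / p)) powr p)"
      using p by (simp add: powr_powr add_nonneg_pos)
    finally show "f \<in> bergman p" unfolding bergman_iff[OF p0] using f powr_ge_zero by blast
  qed
qed (use p bergman_local_bound[OF p] sets_bergman_measure mass_bergman_measure in auto)

subsection \<open>Dilations and average radial integrability\<close>

text \<open>For \<open>c < 1\<close> the function \<open>g (c z)\<close> lives on a larger disc, so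
  it is cut off to meet the convention of \<open>hol_disc\<close>.\<close>

definition dilation :: "real \<Rightarrow> (complex \<Rightarrow> complex) \<Rightarrow> complex \<Rightarrow> complex" where
  "dilation c g z = (if z \<in> disc then g (of_real c * z) else 0)"

lemma dilation_mem_disc: "0 \<le> c \<Longrightarrow> c \<le> 1 \<Longrightarrow> z \<in> disc \<Longrightarrow> of_real c * z \<in> disc"
  using mult_left_le_one_le[of "cmod z" c] by (simp add: disc_def norm_mult)

lemma dilation_hol_disc:
  assumes "g \<in> hol_disc" "0 \<le> c" "c \<le> 1"
  shows "dilation c g \<in> hol_disc"
proof -
  have "(\<lambda>z. of_real c * z) holomorphic_on disc" by (intro holomorphic_intros)
  moreover have "g holomorphic_on disc" using assms by (simp add: hol_disc_def)
  ultimately have "(g \<circ> (\<lambda>z. of_real c * z)) holomorphic_on disc"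
    by (rule holomorphic_on_compose_gen) (use dilation_mem_disc[OF assms(2,3)] in auto)
  then have "(\<lambda>z. g (of_real c * z)) holomorphic_on disc" by (simp add: o_def)
  then show ?thesis
    using holomorphic_transform[of "\<lambda>z. g (of_real c * z)" disc "dilation c g"]
    by (auto simp: hol_disc_def dilation_def)
qed

text \<open>The substitution of \<open>c * r\<close> for \<open>r\<close> costs the factor
  \<open>1 / c\<close> and shortens the radius to \<open>{0<..<c}\<close>.\<close>

lemma radial_integral_dilation:
  assumes g: "g \<in> hol_disc" and c: "0 < c" "c \<le> 1"
  shows "radial_integral p 0 (dilation c g) t \<le> ennreal (1 / c) * radial_integral p 0 g t"
proof -
  note hol_disc_borel[OF g, measurable]
  have "radial_integral p 0 (dilation c g) t
      = (\<integral>\<^sup>+r. ennreal (cmod (g (of_real (0 + c * r) * cis t)) powr p) * indicator {0<..<c} (0 + c * r) \<partial>lborel)"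
    unfolding radial_integral_def
  proof (rule nn_integral_cong)
    fix r :: real
    have "indicator {0<..<c} (0 + c * r) = (indicator {0<..<1} r :: ennreal)"
      using c by (simp add: indicator_def zero_less_mult_iff)
    then show "ennreal (cmod (dilation c g (of_real r * cis t)) powr p) * indicator {0<..<1} r
        = ennreal (cmod (g (of_real (0 + c * r) * cis t)) powr p) * indicator {0<..<c} (0 + c * r)"
      by (cases "0 < r \<and> r < 1") (auto simp: dilation_def disc_def norm_mult mult.assoc)
  qed
  then have "ennreal c * radial_integral p 0 (dilation c g) t
      = ennreal \<bar>c\<bar> * (\<integral>\<^sup>+r. ennreal (cmod (g (of_real (0 + c * r) * cis t)) powr p) * indicator {0<..<c} (0 + c * r) \<partial>lborel)"
    using c by simp
  also have "\<dots> = (\<integral>\<^sup>+r\<in>{0<..<c}. ennreal (cmod (g (of_real r * cis t)) powr p) \<partial>lborel)"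
    using c by (intro nn_integral_real_affine[symmetric]) auto
  also have "\<dots> \<le> radial_integral p 0 g t"
    unfolding radial_integral_def using c by (intro nn_integral_mono mult_left_mono) (auto simp: indicator_def)
  finally have "ennreal (1 / c) * (ennreal c * radial_integral p 0 (dilation c g) t) \<le> ennreal (1 / c) * radial_integral p 0 g t"
    by (rule mult_left_mono) simp
  then show ?thesis
    using c by (simp add: mult.assoc[symmetric] ennreal_mult[symmetric])
qed

text \<open>\<open>dilation c g\<close> is bounded, by compactness of \<open>cball 0 c\<close>, so
  its tails are at most \<open>B powr p * (1 - s)\<close>, uniformly in the angle.\<close>

lemma dilation_RM_zero:
  assumes p: "0 < p" and g: "g \<in> hol_disc" and c: "0 \<le> c" "c < 1"
  shows "dilation c g \<in> RM_zero p"
  unfolding RM_zero_iff[OF p]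
proof (intro conjI allI impI)
  show "dilation c g \<in> hol_disc" using g c by (intro dilation_hol_disc) auto
  obtain B where B: "0 \<le> B" "\<And>z. z \<in> cball 0 c \<Longrightarrow> cmod (g z) \<le> B"
    by (rule hol_disc_bounded_cball[OF g c(2)]) blast
  have bound: "cmod (dilation c g z) \<le> B" for z
  proof (cases "z \<in> disc")
    case True
    then have "of_real c * z \<in> cball 0 c"
      using c mult_left_le[of "cmod z" c] by (simp add: disc_def norm_mult)
    then show ?thesis using B True by (simp add: dilation_def)
  qed (simp add: dilation_def B)
  fix e :: real assume e: "0 < e"
  \<comment> \<open>Solved from \<open>B powr p * (1 - s) \<le> e powr p\<close>; the 1 in the
    denominator prevents division by 0, and \<open>max 0\<close> keeps \<open>s\<close> a
    radius.\<close>
  define s where "s = max 0 (1 - e powr p / (B powr p + 1))"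
  have B1: "0 < B powr p + 1" by (simp add: add_nonneg_pos)
  have s: "0 \<le> s" "s < 1" using e B1 by (auto simp: s_def)
  have "1 - s \<le> e powr p / (B powr p + 1)" by (simp add: s_def)
  then have "B powr p * (1 - s) \<le> (B powr p + 1) * (e powr p / (B powr p + 1))"
    using s by (intro mult_mono) auto
  then have Bs: "B powr p * (1 - s) \<le> e powr p" using B1 by simp
  have "radial_integral p s (dilation c g) t \<le> ennreal (e powr p)" for t
  proof -
    have "radial_integral p s (dilation c g) t \<le> (\<integral>\<^sup>+r\<in>{s<..<1}. ennreal (B powr p) \<partial>lborel)"
      unfolding radial_integral_def using bound p
      by (intro nn_integral_mono mult_right_mono ennreal_leI powr_mono2) auto
    also have "\<dots> = ennreal (B powr p * (1 - s))"
      using s by (simp add: nn_integral_cmult_indicator ennreal_mult)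
    finally show ?thesis using Bs by (meson ennreal_leI order_trans)
  qed
  then show "\<exists>s\<in>{0..<1}. \<forall>t. radial_integral p s (dilation c g) t \<le> ennreal (e powr p)"
    using s by (intro bexI[of _ s]) auto
qed

text \<open>These dilations map a closed disc around \<open>K\<close> into itself, so uniform
  continuity of \<open>g\<close> there applies.\<close>

lemma dilation_uniform_limit:
  assumes g: "g \<in> hol_disc" and c: "\<And>n::nat. 0 \<le> c n" "\<And>n. c n \<le> 1" "c \<longlonglongrightarrow> 1"
    and K: "compact K" "K \<subseteq> disc"
  shows "uniform_limit K (\<lambda>n. dilation (c n) g) g sequentially"
proof (rule uniform_limitI)
  fix e :: real assume "0 < e"
  obtain s where s: "0 \<le> s" "s < 1" "K \<subseteq> cball 0 s"
    using compact_subset_disc_cball[OF K] .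
  have "continuous_on (cball 0 s) g"
    using g cball_subset_disc[OF s(2)]
    by (auto simp: hol_disc_def intro: holomorphic_on_imp_continuous_on continuous_on_subset)
  then have "uniformly_continuous_on (cball 0 s) g"
    by (intro compact_uniformly_continuous) auto
  then obtain d where d: "0 < d" "\<And>z w. z \<in> cball 0 s \<Longrightarrow> w \<in> cball 0 s \<Longrightarrow> dist w z < d \<Longrightarrow> dist (g w) (g z) < e"
    using \<open>0 < e\<close> unfolding uniformly_continuous_on_def by metis
  have "\<forall>\<^sub>F n in sequentially. dist (c n) 1 < d" by (rule tendstoD[OF c(3) d(1)])
  then show "\<forall>\<^sub>F n in sequentially. \<forall>z\<in>K. dist (dilation (c n) g z) (g z) < e"
  proof eventually_elim
    case (elim n)
    show ?case
    proof
      fix z assume z: "z \<in> K"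
      then have zs: "cmod z \<le> s" using s(3) by auto
      have "cmod (of_real (c n) * z) \<le> s"
        using mult_mono[OF c(2)[of n] zs] c(1)[of n] s(1) by (simp add: norm_mult)
      moreover have "dist (of_real (c n) * z) z < d"
      proof -
        have "of_real (c n) * z - z = of_real (c n - 1) * z" by (simp add: algebra_simps)
        then have "dist (of_real (c n) * z) z = \<bar>c n - 1\<bar> * cmod z"
          by (simp only: dist_norm norm_mult norm_of_real)
        also have "\<dots> \<le> \<bar>c n - 1\<bar>"
          using zs s(2) by (intro mult_left_le) auto
        finally show ?thesis using elim by (simp add: dist_real_def)
      qed
      ultimately show "dist (dilation (c n) g z) (g z) < e"
        using d(2)[of z "of_real (c n) * z"] zs z K(2) by (auto simp: dilation_def)
    qed
  qed
qed

text \<open>A mean over the angles is at most the supremum. This also carries the local bound from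
  the Bergman space over to \<open>RM_infty\<close>.\<close>

lemma RM_infty_subset_bergman:
  assumes p: "0 < p" and f: "f \<in> RM_infty p"
  shows "f \<in> bergman p" "bergman_norm p f \<le> RM_infty_norm p f"
proof -
  have fh: "f \<in> hol_disc" using f by (simp add: RM_infty_def)
  have *: "power_integral p bergman_measure UNIV f \<le> ennreal (a powr p)"
    if a: "\<And>t. radial_integral p 0 f t \<le> ennreal (a powr p)" for a
  proof -
    note hol_disc_borel[OF fh, measurable]
    have "power_integral p bergman_measure UNIV f
        = ennreal (1 / (2 * pi)) * (\<integral>\<^sup>+t\<in>{0..2 * pi}. radial_integral p 0 f t \<partial>lborel)"
      using power_integral_radial_measure(1)[OF fh]
      by (simp add: power_integral_def nn_integral_bergman_measure)
    also have "\<dots> \<le> ennreal (1 / (2 * pi)) * (\<integral>\<^sup>+t\<in>{0..2 * pi}. ennreal (a powr p) \<partial>lborel)"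
      by (intro mult_left_mono nn_integral_mono mult_right_mono a) auto
    also have "\<dots> = ennreal (a powr p)"
      by (simp add: nn_integral_cmult_indicator ennreal_mult[symmetric])
    finally show ?thesis .
  qed
  show mem: "f \<in> bergman p" using f * unfolding RM_infty_iff[OF p] bergman_iff[OF p] by blast
  have N: "0 \<le> RM_infty_norm p f" by (simp add: RM_infty_norm_def)
  show "bergman_norm p f \<le> RM_infty_norm p f"
    unfolding bergman_norm_le_iff[OF p mem N]
    using RM_infty_norm_le_iff[OF p f N] by (intro *) simp
qed

lemma radial_space_RM:
  assumes p: "1 < p"
  shows "radial_space p (RM_zero p) (RM_infty p) (RM_infty_norm p) (range radial_measure)"
proof
  have p0: "0 < p" using p by simp
  show "f \<in> RM_infty p \<longleftrightarrow> f \<in> hol_disc \<and> (\<exists>a\<ge>0. \<forall>\<mu>\<in>range radial_measure. power_integral p \<mu> UNIV f \<le> ennreal (a powr p))" for f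
    using power_integral_radial_measure(1)[of f] RM_infty_iff[OF p0, of f] by auto
  show "f \<in> RM_zero p \<longleftrightarrow> f \<in> hol_disc \<and>
      (\<forall>e>0. \<exists>s\<in>{0..<1}. \<forall>\<mu>\<in>range radial_measure. power_integral p \<mu> (- cball 0 s) f \<le> ennreal (e powr p))" for f
  proof (cases "f \<in> hol_disc")
    case True
    have "(\<exists>s\<in>{0..<1}. \<forall>\<mu>\<in>range radial_measure. power_integral p \<mu> (- cball 0 s) f \<le> ennreal (e powr p))
        \<longleftrightarrow> (\<exists>s\<in>{0..<1}. \<forall>t. radial_integral p s f t \<le> ennreal (e powr p))" for e
      using power_integral_radial_measure(2)[OF True] by (intro bex_cong) auto
    then show ?thesis unfolding RM_zero_iff[OF p0] by simp
  qed (simp add: RM_zero_def)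
  show "0 \<le> RM_infty_norm p f" for f by (simp add: RM_infty_norm_def)
  show "RM_infty_norm p f \<le> a \<longleftrightarrow> (\<forall>\<mu>\<in>range radial_measure. power_integral p \<mu> UNIV f \<le> ennreal (a powr p))"
    if "f \<in> RM_infty p" "0 \<le> a" for f a
    using RM_infty_norm_le_iff[OF p0 that] power_integral_radial_measure(1)[of f] that by (simp add: RM_infty_def)
  show "\<exists>C. \<forall>f\<in>RM_infty p. RM_infty_norm p f \<le> 1 \<longrightarrow> (\<forall>z\<in>cball 0 s. cmod (f z) \<le> C)" if "0 \<le> s" "s < 1" for s
    using bergman_local_bound[OF p that] RM_infty_subset_bergman[OF p0] by (meson order_trans)
  show "\<exists>h c. (\<forall>n::nat. h n \<in> RM_zero p \<and> RM_infty_norm p (h n) \<le> c n * RM_infty_norm p g) \<and> c \<longlonglongrightarrow> 1 \<and>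
      (\<forall>K. compact K \<longrightarrow> K \<subseteq> disc \<longrightarrow> uniform_limit K h g sequentially)" if g: "g \<in> RM_infty p" for g
  proof -
    have gh: "g \<in> hol_disc" using g by (simp add: RM_infty_def)
    have N: "0 \<le> RM_infty_norm p g" by (simp add: RM_infty_norm_def)
    \<comment> \<open>The double \<open>Suc\<close> makes \<open>c n\<close> start at 1/2: it is
      positive, as the division below requires.\<close>
    define c where "c n = 1 - inverse (real (Suc (Suc n)))" for n
    have c: "0 < c n" "c n < 1" for n by (auto simp: c_def field_simps)
    have c': "0 \<le> c n" "c n \<le> 1" for n using c[of n] by auto
    have clim: "c \<longlonglongrightarrow> 1"
      unfolding c_def using tendsto_diff[OF tendsto_const LIMSEQ_Suc[OF LIMSEQ_inverse_real_of_nat], of 1] by simp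
    \<comment> \<open>The estimate loses the \<open>p\<close>-th root of the Jacobian
      \<open>1 / c n\<close>, which tends to 1; this is why \<open>approx\<close> allows factors
      with limit 1.\<close>
    have norm: "RM_infty_norm p (dilation (c n) g) \<le> (1 / c n) powr (1 / p) * RM_infty_norm p g" for n
    proof -
      have bound: "radial_integral p 0 (dilation (c n) g) t \<le> ennreal (((1 / c n) powr (1 / p) * RM_infty_norm p g) powr p)" for t
      proof -
        have "radial_integral p 0 (dilation (c n) g) t \<le> ennreal (1 / c n) * radial_integral p 0 g t"
          using c[of n] by (intro radial_integral_dilation gh) auto
        also have "\<dots> \<le> ennreal (1 / c n) * ennreal (RM_infty_norm p g powr p)"
          using RM_infty_norm_le_iff[OF p0 g N] by (intro mult_left_mono) auto
        also have "\<dots> = ennreal (((1 / c n) powr (1 / p) * RM_infty_norm p g) powr p)"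
          using c(1)[of n] N p by (simp add: powr_mult powr_powr ennreal_mult[symmetric])
        finally show ?thesis .
      qed
      have nn: "0 \<le> (1 / c n) powr (1 / p) * RM_infty_norm p g" using N by simp
      have "dilation (c n) g \<in> RM_infty p"
        unfolding RM_infty_iff[OF p0] using c[of n] gh bound nn by (auto intro!: dilation_hol_disc)
      from RM_infty_norm_le_iff[OF p0 this nn] bound show ?thesis by simp
    qed
    have "(\<lambda>n. (1 / c n) powr (1 / p)) \<longlonglongrightarrow> (1 / 1) powr (1 / p)"
      by (intro tendsto_intros clim) auto
    then show ?thesis
      using norm dilation_RM_zero[OF p0 gh c'(1) c(2)] dilation_uniform_limit[OF gh c' clim]
      by (intro exI[of _ "\<lambda>n. dilation (c n) g"] exI[of _ "\<lambda>n. (1 / c n) powr (1 / p)"]) simp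
  qed
qed (use p sets_radial_measure mass_radial_measure in auto)

subsection \<open>The second adjoint of the inclusion\<close>

lemma weak_star_limit_pointwise:
  assumes "limitin (weak_star_topology V N) x l sequentially" "v \<in> V"
  shows "(\<lambda>n::nat. x n v) \<longlonglongrightarrow> l v"
proof (rule topological_tendstoI)
  fix U assume U: "open U" "l v \<in> U"
  let ?W = "{\<phi> \<in> dual_space V N. \<phi> v \<in> U}"
  have l: "l \<in> topspace (weak_star_topology V N)"
    and ev: "\<And>W. openin (weak_star_topology V N) W \<Longrightarrow> l \<in> W \<Longrightarrow> \<forall>\<^sub>F n in sequentially. x n \<in> W"
    using assms(1) by (auto simp: limitin_def)
  have "openin (weak_star_topology V N) ?W"
    unfolding weak_star_topology_def using assms(2) U by (intro topology_generated_by_Basis) blast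
  moreover have "l \<in> dual_space V N"
    using l unfolding weak_star_topology_def topology_generated_by_topspace by auto
  ultimately have "\<forall>\<^sub>F n in sequentially. x n \<in> ?W" using U by (intro ev) auto
  then show "\<forall>\<^sub>F n in sequentially. x n v \<in> U" by eventually_elim simp
qed

lemma continuous_map_norm_topologyI:
  assumes V: "normed_functions V N" and W: "normed_functions W L"
    and T: "\<And>x. x \<in> V \<Longrightarrow> T x \<in> W"
    and le: "\<And>x y. x \<in> V \<Longrightarrow> y \<in> V \<Longrightarrow> L (\<lambda>i. T x i - T y i) \<le> N (\<lambda>i. x i - y i)"
  shows "continuous_map (norm_topology V N) (norm_topology W L) T"
proof -
  interpret V: Metric_space V "norm_dist V N" by (rule normed_functions.Metric_space_norm_dist[OF V])
  interpret W: Metric_space W "norm_dist W L" by (rule normed_functions.Metric_space_norm_dist[OF W])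
  have dist: "norm_dist W L (T x) (T y) \<le> norm_dist V N x y" if "x \<in> V" "y \<in> V" for x y
    using le[OF that] T that by (simp add: norm_dist_def)
  show ?thesis
    unfolding norm_topology_def V.metric_continuous_map[OF W.Metric_space_axioms]
  proof (intro conjI ballI allI impI)
    show "T ` V \<subseteq> W" using T by auto
    fix x e assume "x \<in> V" "0 < (e::real)"
    then show "\<exists>\<delta>>0. \<forall>y. y \<in> V \<and> norm_dist V N x y < \<delta> \<longrightarrow> norm_dist W L (T x) (T y) < e"
      using dist by (intro exI[of _ e]) (auto intro: le_less_trans)
  qed
qed

theorem theorem4p3:
  fixes p :: real
  assumes "1 < p"
  shows "(bij_betw (canonical_embedding (bergman p) (bergman_norm p))
           (bergman p) (bidual_space (bergman p) (bergman_norm p)))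
    \<and> (inclusion_adjoint2 p ` bidual_space (RM_zero p) (RM_infty_norm p)
           \<subseteq> bidual_space (bergman p) (bergman_norm p))
    \<and> (continuous_map
           (norm_topology (bidual_space (RM_zero p) (RM_infty_norm p))
                          (bidual_norm (RM_zero p) (RM_infty_norm p)))
           (norm_topology (bergman p) (bergman_norm p))
           (I_bidual p))
    \<and> (inj_on (I_bidual p) (bidual_space (RM_zero p) (RM_infty_norm p)))
    \<and> (I_bidual p ` bidual_space (RM_zero p) (RM_infty_norm p) = RM_infty p)
    \<and> (\<forall>\<Phi>\<in>bidual_space (RM_zero p) (RM_infty_norm p).
         \<forall>\<Psi>\<in>bidual_space (RM_zero p) (RM_infty_norm p).
           RM_infty_norm p (\<lambda>z. I_bidual p \<Phi> z - I_bidual p \<Psi> z)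
             = bidual_norm (RM_zero p) (RM_infty_norm p) (\<lambda>\<phi>. \<Phi> \<phi> - \<Psi> \<phi>))
    \<and> (\<forall>x :: nat \<Rightarrow> ((complex \<Rightarrow> complex) \<Rightarrow> complex) \<Rightarrow> complex.
           (\<forall>n. x n \<in> bidual_space (RM_zero p) (RM_infty_norm p)) \<longrightarrow>
           (\<exists>C. \<forall>n. bidual_norm (RM_zero p) (RM_infty_norm p) (x n) \<le> C) \<longrightarrow>
           limitin (weak_star_topology (dual_space (RM_zero p) (RM_infty_norm p))
                                       (dual_norm (RM_zero p) (RM_infty_norm p)))
             x (\<lambda>_. 0) sequentially \<longrightarrow>
           (\<forall>K. compact K \<and> K \<subseteq> disc \<longrightarrow>
                uniform_limit K (\<lambda>n. I_bidual p (x n)) (\<lambda>_. 0) sequentially))"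
proof -
  have p: "0 < p" using assms by simp
  interpret A: radial_space p "bergman p" "bergman p" "bergman_norm p" "{bergman_measure}"
    by (rule radial_space_bergman[OF assms])
  interpret R: radial_space p "RM_zero p" "RM_infty p" "RM_infty_norm p" "range radial_measure"
    by (rule radial_space_RM[OF assms])
  let ?B = "bidual_space (RM_zero p) (RM_infty_norm p)"
  let ?N = "bidual_norm (RM_zero p) (RM_infty_norm p)"
  let ?A = "bidual_space (bergman p) (bergman_norm p)"
  let ?can = "canonical_embedding (bergman p) (bergman_norm p)"
  interpret RD: normed_functions "dual_space (RM_zero p) (RM_infty_norm p)" "dual_norm (RM_zero p) (RM_infty_norm p)"
    by (rule R.X.normed_functions_dual)
  interpret RB: normed_functions ?B ?N by (rule RD.normed_functions_dual)
  interpret AD: normed_functions "dual_space (bergman p) (bergman_norm p)" "dual_norm (bergman p) (bergman_norm p)"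
    by (rule A.Y.normed_functions_dual)
  note sub = RM_infty_subset_bergman[OF p R.X_subset_Y]
  \<comment> \<open>The adjoint of the inclusion restricts functionals. It is contractive because
    \<open>RM_infty_norm\<close> dominates the Bergman norm.\<close>
  let ?res = "banach_adjoint (RM_zero p) (\<lambda>f. f)"
  have res: "?res \<phi> \<in> dual_space (RM_zero p) (RM_infty_norm p)"
    "dual_norm (RM_zero p) (RM_infty_norm p) (?res \<phi>) \<le> dual_norm (bergman p) (bergman_norm p) \<phi>"
    if \<phi>: "\<phi> \<in> dual_space (bergman p) (bergman_norm p)" for \<phi>
  proof -
    have le: "cmod (?res \<phi> f) \<le> dual_norm (bergman p) (bergman_norm p) \<phi> * RM_infty_norm p f"
      if f: "f \<in> RM_zero p" for f
      using A.Y.dual_bound[OF \<phi> sub(1)[OF f]] mult_left_mono[OF sub(2)[OF f] A.Y.dual_norm_nonneg[OF \<phi>]] f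
      by (simp add: banach_adjoint_def)
    show "?res \<phi> \<in> dual_space (RM_zero p) (RM_infty_norm p)"
      by (rule R.X.dualI[OF _ _ _ le])
         (use sub(1) in \<open>auto simp: banach_adjoint_def R.X.add R.X.scale A.Y.dual_add[OF \<phi>] A.Y.dual_scale[OF \<phi>]\<close>)
    show "dual_norm (RM_zero p) (RM_infty_norm p) (?res \<phi>) \<le> dual_norm (bergman p) (bergman_norm p) \<phi>"
      by (rule R.X.dual_norm_le_bound[OF A.Y.dual_norm_nonneg[OF \<phi>] le])
  qed
  have adj: "inclusion_adjoint2 p \<Phi> \<in> ?A" if \<Phi>: "\<Phi> \<in> ?B" for \<Phi>
  proof (rule AD.dualI)
    fix \<phi> assume \<phi>: "\<phi> \<in> dual_space (bergman p) (bergman_norm p)"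
    show "cmod (inclusion_adjoint2 p \<Phi> \<phi>) \<le> ?N \<Phi> * dual_norm (bergman p) (bergman_norm p) \<phi>"
      using RD.dual_bound[OF \<Phi> res(1)[OF \<phi>]] mult_left_mono[OF res(2)[OF \<phi>] RD.dual_norm_nonneg[OF \<Phi>]] \<phi>
      by (simp add: inclusion_adjoint2_def banach_adjoint_def[of "dual_space _ _"])
    have "?res (\<lambda>f. c * \<phi> f) = (\<lambda>f. c * ?res \<phi> f)" for c
      by (auto simp: banach_adjoint_def)
    then show "inclusion_adjoint2 p \<Phi> (\<lambda>f. c * \<phi> f) = c * inclusion_adjoint2 p \<Phi> \<phi>" for c
      using \<phi> by (simp add: inclusion_adjoint2_def banach_adjoint_def[of "dual_space _ _"] AD.scale RD.dual_scale[OF \<Phi> res(1)])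
    fix \<psi> assume \<psi>: "\<psi> \<in> dual_space (bergman p) (bergman_norm p)"
    have "?res (\<lambda>f. \<phi> f + \<psi> f) = (\<lambda>f. ?res \<phi> f + ?res \<psi> f)"
      by (auto simp: banach_adjoint_def)
    then show "inclusion_adjoint2 p \<Phi> (\<lambda>f. \<phi> f + \<psi> f) = inclusion_adjoint2 p \<Phi> \<phi> + inclusion_adjoint2 p \<Phi> \<psi>"
      using \<phi> \<psi> by (simp add: inclusion_adjoint2_def banach_adjoint_def[of "dual_space _ _"] AD.add RD.dual_add[OF \<Phi> res(1) res(1)])
  qed (simp add: inclusion_adjoint2_def banach_adjoint_def)
  \<comment> \<open>The evaluation at \<open>z\<close> restricts to the evaluation at
    \<open>z\<close>, so \<Phi> and its image under the second adjoint represent the same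
    function.\<close>
  have rep: "A.represent (inclusion_adjoint2 p \<Phi>) = R.represent \<Phi>" for \<Phi>
  proof
    fix z
    have "?res (evaluation (bergman p) z) = evaluation (RM_zero p) z"
      using sub(1) by (auto simp: banach_adjoint_def evaluation_def)
    then show "A.represent (inclusion_adjoint2 p \<Phi>) z = R.represent \<Phi> z"
      using A.evaluation_X[of z]
      by (simp add: A.represent_def R.represent_def inclusion_adjoint2_def banach_adjoint_def[of "dual_space _ _"])
  qed
  \<comment> \<open>By reflexivity \<open>A.represent\<close> inverts the canonical embedding, which
    makes the identified second adjoint the concrete map \<open>R.represent\<close>.\<close>
  have I: "I_bidual p \<Phi> = R.represent \<Phi>" if "\<Phi> \<in> ?B" for \<Phi>
    unfolding I_bidual_def
    using A.canonical_embedding_represent(1)[OF refl] A.canonical_embedding_represent(2)[OF refl adj[OF that]]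
      A.represent_mem[OF adj[OF that]] rep[of \<Phi>]
    by (intro inv_into_f_eq) (auto simp: bij_betw_def)
  \<comment> \<open>\<open>R.represent\<close> is linear in \<Phi> by definition, so equality of
    norms for the difference is equality of distances.\<close>
  have isometry: "RM_infty_norm p (\<lambda>z. I_bidual p \<Phi> z - I_bidual p \<Psi> z) = ?N (\<lambda>\<phi>. \<Phi> \<phi> - \<Psi> \<phi>)"
    if "\<Phi> \<in> ?B" "\<Psi> \<in> ?B" for \<Phi> \<Psi>
  proof -
    have "R.represent (\<lambda>\<phi>. \<Phi> \<phi> - \<Psi> \<phi>) = (\<lambda>z. R.represent \<Phi> z - R.represent \<Psi> z)"
      by (simp add: R.represent_def fun_eq_iff)
    then show ?thesis using R.represent_norm[OF RB.diff[OF that]] by (simp only: I that)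
  qed
  have mem: "I_bidual p \<Phi> \<in> RM_infty p" if "\<Phi> \<in> ?B" for \<Phi>
    using R.represent_mem[OF that] I[OF that] by simp
  \<comment> \<open>An isometry into \<open>RM_infty\<close> followed by the contractive inclusion
    into the Bergman space.\<close>
  have cont: "continuous_map (norm_topology ?B ?N) (norm_topology (bergman p) (bergman_norm p)) (I_bidual p)"
  proof (rule continuous_map_norm_topologyI[OF RB.normed_functions_axioms A.Y.normed_functions_axioms])
    show "I_bidual p \<Phi> \<in> bergman p" if "\<Phi> \<in> ?B" for \<Phi>
      by (rule RM_infty_subset_bergman(1)[OF p mem[OF that]])
    show "bergman_norm p (\<lambda>z. I_bidual p \<Phi> z - I_bidual p \<Psi> z) \<le> ?N (\<lambda>\<phi>. \<Phi> \<phi> - \<Psi> \<phi>)"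
      if "\<Phi> \<in> ?B" "\<Psi> \<in> ?B" for \<Phi> \<Psi>
      using RM_infty_subset_bergman(2)[OF p R.Y.diff[OF mem[OF that(1)] mem[OF that(2)]]] isometry[OF that] by simp
  qed
  have inj: "inj_on (I_bidual p) ?B"
    using R.represent_inj by (subst inj_on_cong[OF I])
  have range: "I_bidual p ` ?B = RM_infty p"
    using R.represent_surj mem I by (fastforce simp: image_iff)
  have lim: "uniform_limit K (\<lambda>n. I_bidual p (x n)) (\<lambda>_. 0) sequentially"
    if x: "\<And>n::nat. x n \<in> ?B" "\<And>n. ?N (x n) \<le> C"
      and w: "limitin (weak_star_topology (dual_space (RM_zero p) (RM_infty_norm p))
             (dual_norm (RM_zero p) (RM_infty_norm p))) x (\<lambda>_. 0) sequentially"
      and K: "compact K" "K \<subseteq> disc" for x C K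
  proof -
    have "uniform_limit K (\<lambda>n. R.represent (x n)) (\<lambda>_. 0) sequentially"
      by (rule R.represent_uniform_limit_zero[OF x weak_star_limit_pointwise[OF w] K])
    then show ?thesis by (simp add: I[OF x(1)])
  qed
  show ?thesis
    using A.canonical_embedding_represent(1)[OF refl] adj cont inj range isometry lim
    by (intro conjI ballI allI impI; (elim exE conjE)?; blast)
qed

end
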